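(* Let $0<q<1$ and $\epsilon(t)=\frac{a}{t^p}$ with $a>0$ and $q\le p<q+1$. In case $p=q$ and $\gamma>0$, assume further that $a\le\frac{\alpha}{2\gamma}$. Let $x:[t_0,+\infty[\to\mathcal{H}$ be a trajectory generated by (i.e., the global solution, for some $u_0,v_0\in\mathcal{H}$, of) the system (DS) described in the context. Then: (i) $x(t)$ converges strongly, as $t\to+\infty$, to $x^*$, the element of minimum norm of $\operatorname{argmin} g$. (ii) As $t\to+\infty$, $g(x(t)+\beta(t)\dot{x}(t))-\min g=\mathcal{O}\big(t^{-\min(2q,p)}\big)$ and $\|\dot{x}(t)\|=\mathcal{O}\big(t^{-\frac{\min(2q,p)}{2}}\big)$; further, for every $r\in\,]\max(q,p-q),1[$, $\|x(t)-x_t\|=\mathcal{O}\big(t^{r-1}+t^{\frac{2q+r-p-1}{2}}\big)$ as $t\to+\infty$. (iii) If $p>2q$, then $$\int_{t_0}^{+\infty}t^q\big(g_t(x(t)+\beta(t)\dot{x}(t))-g_t(x_t)\big)dt<+\infty,\qquad \int_{t_0}^{+\infty}t^q\|\dot{x}(t)\|^2dt<+\infty,$$ and, moreover, $\int_{t_0}^{+\infty}t^{2q}\|\nabla g(x(t)+\beta(t)\dot{x}(t))+a\,t^{-p}x(t)\|^2dt<+\infty$ if $\gamma>0$, and $\int_{t_0}^{+\infty}t^{2q-1}\|\nabla g(x(t)+\beta(t)\dot{x}(t))\|^2dt<+\infty$ if $\gamma=0$. (iv) If $p>\max\left(\frac{2q+1}{2},2q\right)$ and $\gamma>0$, then $\int_{t_0}^{+\infty}t^{2q}\|\nabla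 g(x(t)+\beta(t)\dot{x}(t))\|^2dt<+\infty$.
   Context: $\mathcal{H}$ is a real Hilbert space with scalar product $\langle\cdot,\cdot\rangle$ and norm $\|\cdot\|$. The function $g:\mathcal{H}\to\mathbb{R}$ is convex and Fréchet differentiable, $\nabla g$ is Lipschitz continuous on bounded sets, and $\operatorname{argmin} g\neq\emptyset$. Parameters: $t_0>0$, $\alpha>0$, $0<q<1$, and either ($\gamma>0$ and $\beta\in\mathbb{R}$) or ($\gamma=0$ and $\beta>0$); if $\beta<0$ then also $t_0>\left|\frac{\beta}{\gamma}\right|^{1/q}$. Notation: $\beta(t)=\gamma+\frac{\beta}{t^q}$ (so $\beta(t)>0$ on $[t_0,+\infty[$). The system (DS) is $$\ddot{x}(t)+\frac{\alpha}{t^q}\dot{x}(t)+\nabla g\big(x(t)+\beta(t)\dot{x}(t)\big)+\epsilon(t)x(t)=0,\qquad x(t_0)=u_0,\ \dot{x}(t_0)=v_0;$$ it has a unique global solution on $[t_0,+\infty[$ for all $u_0,v_0\in\mathcal{H}$. For $t\ge t_0$, $g_t:\mathcal{H}\to\mathbb{R}$ is the strongly convex function $g_t(x)=g(x)+\frac{\epsilon(t)}{2}\|x\|^2$, and $x_t$ denotes its unique minimizer over $\mathcal{H}$. *)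

theory Defs
  imports "HOL-Analysis.Analysis" "HOL-Library.Landau_Symbols"
begin

(* By the Riesz theorem the description is well defined at every point where g is
   Frechet differentiable, provided the space is complete. *)
definition grad :: "('a::real_inner \<Rightarrow> real) \<Rightarrow> 'a \<Rightarrow> 'a" where
  "grad g x = (THE D. GDERIV g x :> D)"

definition argmin_set :: "('a \<Rightarrow> real) \<Rightarrow> 'a set" where
  "argmin_set g = {x. is_arg_min g (\<lambda>_. True) x}"

definition min_norm_minimizer :: "('a::real_normed_vector \<Rightarrow> real) \<Rightarrow> 'a" where
  "min_norm_minimizer g = arg_min norm (\<lambda>z. z \<in> argmin_set g)"

(* The function g_t, with e standing for the value epsilon(t). *)
definition tikhonov :: "('a::real_normed_vector \<Rightarrow> real) \<Rightarrow> real \<Rightarrow> 'a \<Rightarrow> real" where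
  "tikhonov g e y = g y + e / 2 * (norm y)\<^sup>2"

(* The point x_t; the minimizer is unique when g is convex and continuous, e > 0 and the
   space is complete. *)
definition tikhonov_min :: "('a::real_normed_vector \<Rightarrow> real) \<Rightarrow> real \<Rightarrow> 'a" where
  "tikhonov_min g e = arg_min (tikhonov g e) (\<lambda>_. True)"

(* Derivative of a curve on [t0, infinity), one-sided at t0; values of the curve before t0
   play no role. *)
definition velocity :: "real \<Rightarrow> (real \<Rightarrow> 'a::real_normed_vector) \<Rightarrow> real \<Rightarrow> 'a" where
  "velocity t0 x t = vector_derivative x (at t within {t0..})"

definition beta_coeff :: "real \<Rightarrow> real \<Rightarrow> real \<Rightarrow> real \<Rightarrow> real" where
  "beta_coeff \<gamma> \<beta> q t = \<gamma> + \<beta> / t powr q"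

(* The point x(t) + beta(t) x'(t) at which g and its gradient are evaluated. *)
definition shifted ::
  "real \<Rightarrow> real \<Rightarrow> real \<Rightarrow> real \<Rightarrow> (real \<Rightarrow> 'a::real_normed_vector) \<Rightarrow> real \<Rightarrow> 'a" where
  "shifted t0 \<gamma> \<beta> q x t = x t + beta_coeff \<gamma> \<beta> q t *\<^sub>R velocity t0 x t"

definition DS_solution ::
  "('a::real_inner \<Rightarrow> real) \<Rightarrow> real \<Rightarrow> real \<Rightarrow> real \<Rightarrow> real \<Rightarrow> real \<Rightarrow> (real \<Rightarrow> real)
    \<Rightarrow> 'a \<Rightarrow> 'a \<Rightarrow> (real \<Rightarrow> 'a) \<Rightarrow> bool" where
  "DS_solution g t0 \<alpha> q \<gamma> \<beta> \<epsilon> u0 v0 x \<longleftrightarrow>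
     (x differentiable_on {t0..}) \<and> (velocity t0 x differentiable_on {t0..}) \<and>
     (\<forall>t\<ge>t0. velocity t0 (velocity t0 x) t + (\<alpha> / t powr q) *\<^sub>R velocity t0 x t
        + grad g (shifted t0 \<gamma> \<beta> q x t) + \<epsilon> t *\<^sub>R x t = 0) \<and>
     x t0 = u0 \<and> velocity t0 x t0 = v0"

end

theory Submission
  imports Defs
begin

text \<open>
  Write \<open>y = x + \<beta>(t) x'\<close>, \<open>N = \<nabla>g\<^sub>t(y)\<close>, \<open>b = \<beta>(t)\<close>, \<open>d = \<alpha> / t\<^sup>q - \<epsilon>(t) b\<close> and \<open>w = x - x\<^sub>t\<close>. The system reads
  \<open>x'' = - d x' - N\<close>. With \<open>s = t powr (-q)\<close> and \<open>c\<close> half the limit of \<open>d / s\<close>, the energy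
  \<open>E = g\<^sub>t(y) - g\<^sub>t(x\<^sub>t) + norm x' ^ 2 / 2 + c s \<langle>x', w\<rangle> + c ^ 2 s ^ 2 norm w ^ 2\<close>
  is positive definite, and convexity applied to \<open>\<langle>N, y - x\<^sub>t\<rangle>\<close> gives, for large \<open>t\<close>, a bound on its
  derivative by \<open>- b/2 norm N ^ 2 - c s (g\<^sub>t(y) - g\<^sub>t(x\<^sub>t)) - 3/8 c s norm x' ^ 2 - c/8 s \<epsilon>(t) norm w ^ 2\<close>
  plus an error \<open>K t powr (- \<sigma>)\<close> caused by the motion of \<open>x\<^sub>t\<close> and of \<open>\<epsilon>\<close>. Hence \<open>E\<close> is damped at rate
  \<open>t powr (- \<rho>)\<close> with \<open>\<rho> = max q (p - q)\<close>, so \<open>E = O(t powr (\<rho> - \<sigma>))\<close>, which contains all rates and,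
  together with \<open>x\<^sub>t \<longlonglongrightarrow> x*\<close>, the strong convergence. Integrating the inequality multiplied by
  \<open>t powr (2 * q)\<close> gives the integral estimates. Since \<open>x\<^sub>t\<close> is merely locally Lipschitz in \<open>t\<close>,
  derivatives of \<open>E\<close> are understood as bounds on upper right Dini derivatives.
\<close>

section \<open>Upper right Dini derivatives\<close>

text \<open>The energy is tied to the friction. Differentiating \<open>c s <v, w>\<close> produces
  \<open>- c s d <v, w>\<close>, and differentiating \<open>c ^ 2 s ^ 2 norm w ^ 2\<close> produces
  \<open>2 c ^ 2 s ^ 2 <v, w>\<close>; these cancel to leading order exactly when \<open>d\<close>
  behaves like \<open>2 c s\<close>, which dictates \<open>c\<close>. The quadratic form in
  \<open>v\<close> and \<open>s w\<close> is then definite because c^2 < 2 c^2. The distance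
  \<open>w\<close> is damped only through strong convexity, with strength
  \<open>s eps norm w ^ 2\<close>, whereas the energy contains \<open>s ^ 2 norm w ^ 2\<close>. The
  ratio eps / s is therefore the second candidate for the damping rate, and it separates the ranges
  p \<le> 2 q and p > 2 q. The regularized minimizer moves with speed of order |eps'| / eps, that is
  1 / t; absorbing this motion into the weak damping of \<open>w\<close> costs a division by eps.
  For \<gamma> = 0 there is a further obstacle: \<open>b\<close> tends to 0, so the term
  \<open>b norm N ^ 2\<close> degenerates, and the mixed terms with \<open>N\<close> have to be
  estimated relative to \<open>b\<close>.\<close>

definition dini_le :: "(real \<Rightarrow> real) \<Rightarrow> real \<Rightarrow> real \<Rightarrow> bool" where
  "dini_le F t D \<longleftrightarrow> (\<forall>e>0. \<forall>\<^sub>F s in at_right t. F s - F t \<le> (D + e) * (s - t))"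

text \<open>The energy contains a curve of minimizers that need not be differentiable. Its Dini
  bound comes from here: its increments to the right of \<open>t\<close> are compared with those of
  a differentiable \<open>K\<close>.\<close>

lemma dini_le_majorant:
  assumes K: "(K has_real_derivative D) (at t)"
    and le: "\<And>s. s > t \<Longrightarrow> F s - F t \<le> K s - K t"
  shows "dini_le F t D"
  unfolding dini_le_def
proof (intro allI impI)
  fix e :: real assume "e > 0"
  have "((\<lambda>s. (K s - K t) / (s - t)) \<longlongrightarrow> D) (at_right t)"
    using K unfolding has_field_derivative_iff
    by (rule tendsto_mono[rotated]) (simp add: at_le)
  then have "\<forall>\<^sub>F s in at_right t. (K s - K t) / (s - t) < D + e"
    using \<open>e > 0\<close> by (intro order_tendstoD(2)) auto
  moreover have "\<forall>\<^sub>F s in at_right t. s > t"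
    by (simp add: eventually_at_right_less)
  ultimately show "\<forall>\<^sub>F s in at_right t. F s - F t \<le> (D + e) * (s - t)"
  proof eventually_elim
    case (elim s)
    then have "K s - K t \<le> (D + e) * (s - t)" by (simp add: pos_divide_less_eq)
    with le[of s] elim show ?case by linarith
  qed
qed

lemma dini_le_deriv: "(K has_real_derivative D) (at t) \<Longrightarrow> dini_le K t D"
  by (rule dini_le_majorant) auto

lemma dini_le_mono: "dini_le F t D \<Longrightarrow> D \<le> D' \<Longrightarrow> dini_le F t D'"
  unfolding dini_le_def
proof (intro allI impI)
  fix e :: real assume h: "\<forall>e>0. \<forall>\<^sub>F s in at_right t. F s - F t \<le> (D + e) * (s - t)" "D \<le> D'" "e > 0"
  then have "\<forall>\<^sub>F s in at_right t. F s - F t \<le> (D + e) * (s - t)" by blast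
  moreover have "\<forall>\<^sub>F s in at_right t. s > t"
    by (simp add: eventually_at_right_less)
  ultimately show "\<forall>\<^sub>F s in at_right t. F s - F t \<le> (D' + e) * (s - t)"
  proof eventually_elim
    case (elim s)
    have "(D + e) * (s - t) \<le> (D' + e) * (s - t)"
      using elim h by (intro mult_right_mono) auto
    with elim show ?case by linarith
  qed
qed

lemma dini_le_add:
  assumes "dini_le F t D" "dini_le G t D'"
  shows "dini_le (\<lambda>s. F s + G s) t (D + D')"
  unfolding dini_le_def
proof (intro allI impI)
  fix e :: real assume "e > 0"
  then have "\<forall>\<^sub>F s in at_right t. F s - F t \<le> (D + e/2) * (s - t)"
    "\<forall>\<^sub>F s in at_right t. G s - G t \<le> (D' + e/2) * (s - t)"
    using assms unfolding dini_le_def by (meson half_gt_zero)+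
  then show "\<forall>\<^sub>F s in at_right t. F s + G s - (F t + G t) \<le> (D + D' + e) * (s - t)"
  proof eventually_elim
    case (elim s)
    have "(D + e/2) * (s - t) + (D' + e/2) * (s - t) = (D + D' + e) * (s - t)"
      by (simp add: algebra_simps)
    with elim show ?case by linarith
  qed
qed

text \<open>A one-sided bound survives multiplication only by a positive factor; positivity near
  \<open>t\<close> follows from that at \<open>t\<close> by continuity.\<close>

lemma dini_le_mult:
  assumes f: "(f has_real_derivative f') (at t)" and pos: "f t > 0" and F: "dini_le F t D"
  shows "dini_le (\<lambda>s. f s * F s) t (f t * D + f' * F t)"
  unfolding dini_le_def
proof (intro allI impI)
  fix e :: real assume e: "e > 0"
  have tr: "(h \<longlongrightarrow> l) (at t) \<Longrightarrow> (h \<longlongrightarrow> l) (at_right t)" for h :: "real \<Rightarrow> real" and l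
    by (rule tendsto_mono[rotated]) (auto simp: at_le)
  \<comment> \<open>The slack of \<open>F\<close> gets multiplied by a factor tending to
    \<open>f t\<close>, so \<open>e1\<close> contributes e / 2 in the limit; the other half of
    \<open>e\<close> absorbs the passage to the limit.\<close>
  define e1 where "e1 = e / (2 * f t)"
  have e1: "e1 > 0" using e pos by (simp add: e1_def)
  have cf: "(f \<longlongrightarrow> f t) (at_right t)"
    using DERIV_isCont[OF f] unfolding isCont_def by (rule tr)
  have "((\<lambda>s. f s * (D + e1) + (f s - f t) / (s - t) * F t) \<longlongrightarrow> f t * (D + e1) + f' * F t) (at_right t)"
    using f unfolding has_field_derivative_iff by (intro tendsto_intros cf tr)
  moreover have "f t * (D + e1) + f' * F t < f t * D + f' * F t + e"
    using pos e by (simp add: e1_def field_simps)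
  ultimately have "\<forall>\<^sub>F s in at_right t. f s * (D + e1) + (f s - f t) / (s - t) * F t < f t * D + f' * F t + e"
    by (rule order_tendstoD(2))
  moreover have "\<forall>\<^sub>F s in at_right t. f s > 0"
    using cf pos by (rule order_tendstoD(1))
  moreover have "\<forall>\<^sub>F s in at_right t. F s - F t \<le> (D + e1) * (s - t)"
    using F e1 unfolding dini_le_def by blast
  moreover have "\<forall>\<^sub>F s in at_right t. s > t"
    by (simp add: eventually_at_right_less)
  ultimately show "\<forall>\<^sub>F s in at_right t. f s * F s - f t * F t \<le> (f t * D + f' * F t + e) * (s - t)"
  proof eventually_elim
    case (elim s)
    have "f s * F s - f t * F t = f s * (F s - F t) + (f s - f t) * F t" by (simp add: algebra_simps)
    also have "\<dots> \<le> f s * ((D + e1) * (s - t)) + (f s - f t) * F t"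
      using elim by (intro add_right_mono mult_left_mono) auto
    also have "\<dots> = (f s * (D + e1) + (f s - f t) / (s - t) * F t) * (s - t)"
      using elim by (simp add: field_simps)
    also have "\<dots> \<le> (f t * D + f' * F t + e) * (s - t)"
      using elim by (intro mult_right_mono) auto
    finally show ?case .
  qed
qed

text \<open>Replaces the mean value theorem. For each e > 0 the times at which
  \<open>F t - e * t\<close> does not exceed its initial value form a compact set. Its last element
  must be \<open>w\<close>, since the Dini bound would carry the inequality a little further to the
  right.\<close>

lemma dini_le_nonincreasing:
  fixes F :: "real \<Rightarrow> real"
  assumes cont: "continuous_on {u..w} F" and D: "\<And>t. u \<le> t \<Longrightarrow> t < w \<Longrightarrow> dini_le F t 0" and uw: "u \<le> w"
  shows "F w \<le> F u"
proof -
  have "F w \<le> F u + e * (w - u)" if e: "e > 0" for e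
  proof -
    define S where "S = {t \<in> {u..w}. F t - e * t \<le> F u - e * u}"
    have "closed S" unfolding S_def
      by (intro continuous_on_closed_Collect_le continuous_intros cont)
    moreover have "bounded S"
      by (rule bounded_subset[of "{u..w}"]) (auto simp: S_def)
    ultimately have "compact S" by (simp add: compact_eq_bounded_closed)
    moreover have "u \<in> S" using uw by (simp add: S_def)
    ultimately obtain \<tau> where \<tau>: "\<tau> \<in> S" "\<And>s. s \<in> S \<Longrightarrow> s \<le> \<tau>"
      using compact_attains_sup[of S] by blast
    have "\<tau> = w"
    proof (rule ccontr)
      assume "\<tau> \<noteq> w"
      with \<tau> have lt: "u \<le> \<tau>" "\<tau> < w" by (auto simp: S_def)
      have "\<forall>\<^sub>F s in at_right \<tau>. F s - F \<tau> \<le> e * (s - \<tau>)"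
        using D[OF lt] e unfolding dini_le_def by auto
      moreover have "\<forall>\<^sub>F s in at_right \<tau>. s \<in> {\<tau><..<w}"
        using lt by (intro eventually_at_right_real)
      ultimately have "\<forall>\<^sub>F s in at_right \<tau>. s > \<tau> \<and> s \<in> S"
      proof eventually_elim
        case (elim s)
        then show ?case using \<tau>(1) lt by (auto simp: S_def algebra_simps)
      qed
      then obtain s where "s > \<tau>" "s \<in> S"
        by (metis (mono_tags, lifting) eventually_happens' trivial_limit_at_right_real)
      then show False using \<tau>(2) by force
    qed
    then show ?thesis using \<tau>(1) by (simp add: S_def algebra_simps)
  qed
  then have "F w - F u \<le> e" if "e > 0" for e
    using that uw
  proof (cases "w = u")
    case False
    then have "w - u > 0" using uw by simp
    then show ?thesis using \<open>\<And>e. e > 0 \<Longrightarrow> F w \<le> F u + e * (w - u)\<close>[of "e / (w - u)"] that by simp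
  qed auto
  then show ?thesis by (metis diff_le_0_iff_le field_le_epsilon add_0)
qed

text \<open>A Gronwall argument: the integrating factor \<open>\<mu>\<close> has logarithmic
  derivative k t^(-\<rho>), so \<mu> (Z - M / k) is nonincreasing. As \<open>\<mu>\<close> grows,
  \<open>Z t\<close> cannot exceed both bounds at once.\<close>

lemma dini_le_decay:
  fixes Z :: "real \<Rightarrow> real"
  assumes cont: "continuous_on {T..} Z" and T: "T > 0" and k: "k > 0" and r: "\<rho> < 1"
    and D: "\<And>t. t \<ge> T \<Longrightarrow> dini_le Z t (- k * t powr (-\<rho>) * Z t + M * t powr (-\<rho>))"
    and t: "t \<ge> T"
  shows "Z t \<le> max (Z T) (M / k)"
proof -
  define \<mu> where "\<mu> = (\<lambda>t::real. exp (k / (1 - \<rho>) * t powr (1 - \<rho>)))"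
  define F where "F = (\<lambda>t. \<mu> t * (Z t + (- (M / k))))"
  have "continuous_on {T..} \<mu>" unfolding \<mu>_def using T by (intro continuous_intros) auto
  then have cF: "continuous_on {T..} F" unfolding F_def by (intro continuous_intros cont)
  have "F t \<le> F T"
  proof (rule dini_le_nonincreasing[where F = F])
    show "continuous_on {T..t} F" by (rule continuous_on_subset[OF cF]) auto
    show "T \<le> t" by fact
    fix s assume s: "T \<le> s" "s < t"
    have "((\<lambda>t. k / (1 - \<rho>) * t powr (1 - \<rho>)) has_real_derivative
        k / (1 - \<rho>) * ((1 - \<rho>) * s powr (1 - \<rho> - 1))) (at s)"
      using s T by (intro DERIV_cmult has_real_derivative_powr) auto
    then have "((\<lambda>t. k / (1 - \<rho>) * t powr (1 - \<rho>)) has_real_derivative k * s powr (-\<rho>)) (at s)"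
      using r by simp
    then have "(\<mu> has_real_derivative \<mu> s * (k * s powr (-\<rho>))) (at s)"
      unfolding \<mu>_def by (rule DERIV_fun_exp)
    moreover have "dini_le (\<lambda>t. Z t + (- (M / k))) s (- k * s powr (-\<rho>) * Z s + M * s powr (-\<rho>) + 0)"
      using s by (intro dini_le_add D dini_le_deriv DERIV_const) auto
    ultimately have "dini_le F s (\<mu> s * (- k * s powr (-\<rho>) * Z s + M * s powr (-\<rho>) + 0)
        + \<mu> s * (k * s powr (-\<rho>)) * (Z s + (- (M / k))))"
      unfolding F_def by (intro dini_le_mult) (auto simp: \<mu>_def)
    moreover have "\<mu> s * (- k * s powr (-\<rho>) * Z s + M * s powr (-\<rho>) + 0)
        + \<mu> s * (k * s powr (-\<rho>)) * (Z s + (- (M / k))) = 0"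
      using k by (simp add: field_simps)
    ultimately show "dini_le F s 0" by simp
  qed
  then have 1: "\<mu> t * (Z t - M / k) \<le> \<mu> T * (Z T - M / k)" by (simp add: F_def)
  have "\<mu> T \<le> \<mu> t" "\<mu> T > 0" unfolding \<mu>_def using t T k r
    by (auto intro!: divide_right_mono mult_left_mono powr_mono2)
  show ?thesis
  proof (rule ccontr)
    assume "\<not> ?thesis"
    then have h: "Z t - M / k > 0" "Z t - M / k > Z T - M / k" by auto
    have "\<mu> T * (Z T - M / k) < \<mu> T * (Z t - M / k)" using h \<open>\<mu> T > 0\<close> by simp
    also have "\<dots> \<le> \<mu> t * (Z t - M / k)" using h \<open>\<mu> T \<le> \<mu> t\<close> by (intro mult_right_mono) auto
    finally show False using 1 by simp
  qed
qed

section \<open>Integrability over half lines\<close>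

lemma set_integrable_of_bounded_integrals:
  fixes f :: "real \<Rightarrow> real"
  assumes cont: "continuous_on {T..} f" and nonneg: "\<And>t. t \<ge> T \<Longrightarrow> f t \<ge> 0"
    and bound: "\<And>t. t \<ge> T \<Longrightarrow> integral {T..t} f \<le> M"
  shows "set_integrable lborel {T..} f"
proof -
  define A where "A = (\<lambda>i::nat. {T..T + real i})"
  have int: "set_integrable lborel (A i) f" for i
    unfolding A_def by (rule borel_integrable_atLeastAtMost', rule continuous_on_subset[OF cont]) auto
  have eq: "(LINT x:A i|lborel. f x) = integral (A i) f" for i
    by (rule set_borel_integral_eq_integral(2)[OF int])
  have "incseq (\<lambda>i. integral (A i) f)"
    by (intro incseq_SucI integral_subset_le set_borel_integral_eq_integral(1) int)
      (auto simp: A_def nonneg)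
  moreover have "integral (A i) f \<le> M" for i
    unfolding A_def by (rule bound) simp
  ultimately obtain L where "(\<lambda>i. integral (A i) f) \<longlonglongrightarrow> L"
    using incseq_convergent by blast
  then have "(\<lambda>i. LINT x:A i|lborel. f x) \<longlonglongrightarrow> L" by (simp add: eq)
  then have "set_integrable lborel (\<Union>i. A i) f"
    by (intro pos_integrable_to_top[where l = L] int) (auto simp: A_def mono_def nonneg)
  moreover have "(\<Union>i. A i) = {T..}"
  proof safe
    fix t assume "T \<le> t"
    moreover obtain i where "t - T \<le> real i" using real_arch_simple by blast
    ultimately show "t \<in> (\<Union>i. A i)" by (auto simp: A_def intro!: exI[of _ i])
  qed (auto simp: A_def)
  ultimately show ?thesis by simp
qed

lemma set_integrable_tail_bound:
  fixes f h :: "real \<Rightarrow> real"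
  assumes cont: "continuous_on {T0..} f" and "T0 \<le> T" and h: "set_integrable lborel {T..} h"
    and bound: "\<And>t. t \<ge> T \<Longrightarrow> \<bar>f t\<bar> \<le> h t"
  shows "set_integrable lborel {T0..} f"
proof -
  have "set_integrable lborel {T..} f"
  proof (rule set_integrable_bound[OF h])
    show "set_borel_measurable lborel {T..} f"
      unfolding set_borel_measurable_def
      using borel_measurable_continuous_on_indicator[OF _ continuous_on_subset[OF cont], of "{T..}"] \<open>T0 \<le> T\<close>
      by simp
    show "AE x in lborel. x \<in> {T..} \<longrightarrow> norm (f x) \<le> norm (h x)"
      using bound by (intro AE_I2) force
  qed
  moreover have "set_integrable lborel {T0..T} f"
    by (rule borel_integrable_atLeastAtMost', rule continuous_on_subset[OF cont]) auto
  ultimately have "set_integrable lborel ({T0..T} \<union> {T..}) f"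
    by (intro set_integrable_Un) auto
  also have "{T0..T} \<union> {T..} = {T0..}" using \<open>T0 \<le> T\<close> by auto
  finally show ?thesis .
qed

lemma set_integrable_powr:
  fixes T k :: real
  assumes "T > 0" "k < - 1"
  shows "set_integrable lborel {T..} (\<lambda>t. t powr k)"
proof (rule set_integrable_of_bounded_integrals)
  show "continuous_on {T..} (\<lambda>t. t powr k)" using assms by (intro continuous_intros) auto
  fix t assume t: "t \<ge> T"
  have "((\<lambda>t. t powr k) has_integral (t powr (k + 1) / (k + 1) - T powr (k + 1) / (k + 1))) {T..t}"
  proof (rule fundamental_theorem_of_calculus)
    fix s assume s: "s \<in> {T..t}"
    have "((\<lambda>s. s powr (k + 1) / (k + 1)) has_real_derivative (k + 1) * s powr (k + 1 - 1) / (k + 1)) (at s)"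
      using s assms by (intro DERIV_cdivide has_real_derivative_powr) auto
    then show "((\<lambda>s. s powr (k + 1) / (k + 1)) has_vector_derivative s powr k) (at s within {T..t})"
      using assms by (auto simp: has_real_derivative_iff_has_vector_derivative intro: has_vector_derivative_at_within)
  qed fact
  then have "integral {T..t} (\<lambda>t. t powr k) = t powr (k + 1) / (k + 1) - T powr (k + 1) / (k + 1)"
    by (rule integral_unique)
  also have "\<dots> \<le> - (T powr (k + 1) / (k + 1))"
    using assms by (simp add: divide_nonneg_neg)
  finally show "integral {T..t} (\<lambda>t. t powr k) \<le> - (T powr (k + 1) / (k + 1))" .
qed auto

text \<open>Integrates a dissipation inequality without a derivative of \<open>Z\<close>: adding to
  \<open>Z\<close> the primitives of \<open>N\<close> and of - M t^k gives a nonincreasing function.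
  Both \<open>Z\<close> and the last primitive are nonnegative, the latter because k < -1, so the
  integrals of \<open>N\<close> stay bounded.\<close>

lemma dini_le_integrable:
  fixes Z N :: "real \<Rightarrow> real"
  assumes Z: "continuous_on {T..} Z" "\<And>t. t \<ge> T \<Longrightarrow> Z t \<ge> 0"
    and N: "continuous_on {T..} N" "\<And>t. t \<ge> T \<Longrightarrow> N t \<ge> 0"
    and T: "T > 0" and k: "k < - 1" and M: "M \<ge> 0"
    and D: "\<And>t. t \<ge> T \<Longrightarrow> dini_le Z t (- N t + M * t powr k)"
  shows "set_integrable lborel {T+1..} N"
proof (rule set_integrable_of_bounded_integrals)
  show "continuous_on {T+1..} N" by (rule continuous_on_subset[OF N(1)]) auto
  show "N t \<ge> 0" if "t \<ge> T + 1" for t using N(2) that by simp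
  fix t assume t: "t \<ge> T + 1"
  have ig: "N integrable_on {T..w}" for w
    by (rule integrable_continuous_real, rule continuous_on_subset[OF N(1)]) auto
  \<comment> \<open>The integral starts at \<open>T\<close> but monotonicity is used only from
    \<open>T + 1\<close> on, where every point is interior and the indefinite integral has a
    two-sided derivative.\<close>
  define F where "F = (\<lambda>s. Z s + (integral {T..s} N + - (M / (k + 1) * s powr (k + 1))))"
  have "F t \<le> F (T + 1)"
  proof (rule dini_le_nonincreasing[where F = F])
    have "continuous_on {T + 1..t} (\<lambda>s. integral {T..s} N)"
      by (rule continuous_on_subset[OF indefinite_integral_continuous_1[OF ig[of t]]]) auto
    then show "continuous_on {T + 1..t} F" unfolding F_def using T k
      by (intro continuous_intros continuous_on_subset[OF Z(1)]) auto
    show "T + 1 \<le> t" by fact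
    fix s assume s: "T + 1 \<le> s" "s < t"
    have "((\<lambda>s. integral {T..s} N) has_real_derivative N s) (at s within {T..t})"
      using s by (intro integral_has_real_derivative continuous_on_subset[OF N(1)]) auto
    then have "((\<lambda>s. integral {T..s} N) has_real_derivative N s) (at s)"
      using s by (metis add_strict_increasing at_within_Icc_at less_add_one less_le_trans)
    moreover have "((\<lambda>s. - (M / (k + 1) * s powr (k + 1))) has_real_derivative - (M / (k + 1) * ((k + 1) * s powr (k + 1 - 1)))) (at s)"
      using s T by (intro DERIV_minus DERIV_cmult has_real_derivative_powr) auto
    ultimately have "dini_le F s ((- N s + M * s powr k) + (N s + - (M / (k + 1) * ((k + 1) * s powr (k + 1 - 1)))))"
      unfolding F_def using s by (intro dini_le_add D dini_le_deriv) auto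
    then show "dini_le F s 0" using k by simp
  qed
  moreover have "integral {T + 1..t} N \<le> integral {T..t} N"
    using t ig N(2)
    by (intro integral_subset_le) (auto intro: integrable_on_subinterval[OF ig[of t]])
  moreover have "Z t \<ge> 0" using Z(2) t by simp
  moreover have "- (M / (k + 1) * t powr (k + 1)) \<ge> 0"
    using M k by (simp add: divide_nonneg_neg mult_nonpos_nonneg)
  ultimately show "integral {T + 1..t} N \<le> F (T + 1)" by (simp add: F_def)
qed

section \<open>Tikhonov regularization\<close>

lemma tikhonov_convex_comb:
  fixes g :: "'a::real_inner \<Rightarrow> real"
  assumes g: "convex_on UNIV g" and s: "0 \<le> s" "s \<le> 1"
  shows "tikhonov g e ((1 - s) *\<^sub>R x + s *\<^sub>R z)
    \<le> (1 - s) * tikhonov g e x + s * tikhonov g e z - e / 2 * (s * (1 - s)) * (norm (z - x))\<^sup>2"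
proof -
  have "g ((1 - s) *\<^sub>R x + s *\<^sub>R z) \<le> (1 - s) * g x + s * g z"
    using g s by (intro convex_onD) auto
  moreover have "(norm ((1 - s) *\<^sub>R x + s *\<^sub>R z))\<^sup>2
      = (1 - s) * (norm x)\<^sup>2 + s * (norm z)\<^sup>2 - s * (1 - s) * (norm (z - x))\<^sup>2"
    by (simp add: power2_norm_eq_inner inner_commute algebra_simps)
  ultimately have "tikhonov g e ((1 - s) *\<^sub>R x + s *\<^sub>R z) \<le> (1 - s) * g x + s * g z
      + e / 2 * ((1 - s) * (norm x)\<^sup>2 + s * (norm z)\<^sup>2 - s * (1 - s) * (norm (z - x))\<^sup>2)"
    by (simp only: tikhonov_def)
  then show ?thesis by (simp add: tikhonov_def algebra_simps add_divide_distrib diff_divide_distrib)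
qed

text \<open>Minimality is tested along the segment from \<open>x\<close> to \<open>z\<close>.
  Dividing by the parameter s and letting it tend to 0 recovers the full modulus e / 2, and no
  gradient enters.\<close>

lemma tikhonov_min_strong:
  fixes g :: "'a::real_inner \<Rightarrow> real"
  assumes g: "convex_on UNIV g" and e: "e > 0" and x: "\<And>y. tikhonov g e x \<le> tikhonov g e y"
  shows "tikhonov g e x + e / 2 * (norm (z - x))\<^sup>2 \<le> tikhonov g e z"
proof -
  have "e / 2 * (1 - s) * (norm (z - x))\<^sup>2 \<le> tikhonov g e z - tikhonov g e x" if s: "s \<in> {0<..<1}" for s
  proof -
    have "tikhonov g e x \<le> (1 - s) * tikhonov g e x + s * tikhonov g e z - e / 2 * (s * (1 - s)) * (norm (z - x))\<^sup>2"
      using tikhonov_convex_comb[OF g, of s e x z] x[of "(1 - s) *\<^sub>R x + s *\<^sub>R z"] s by auto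
    then have "s * (e / 2 * (1 - s) * (norm (z - x))\<^sup>2) \<le> s * (tikhonov g e z - tikhonov g e x)"
      by (simp add: algebra_simps)
    then show ?thesis using s by simp
  qed
  then have "\<forall>\<^sub>F s in at_right 0. e / 2 * (1 - s) * (norm (z - x))\<^sup>2 \<le> tikhonov g e z - tikhonov g e x"
    using eventually_at_right_real[of 0 "1::real"] by (auto elim!: eventually_mono)
  moreover have "((\<lambda>s. e / 2 * (1 - s) * (norm (z - x))\<^sup>2) \<longlongrightarrow> e / 2 * (1 - 0) * (norm (z - x))\<^sup>2) (at_right 0)"
    by (intro tendsto_intros)
  ultimately have "e / 2 * (1 - 0) * (norm (z - x))\<^sup>2 \<le> tikhonov g e z - tikhonov g e x"
    by (intro tendsto_upperbound) auto
  then show ?thesis by simp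
qed

text \<open>Strong convexity makes every minimizing sequence Cauchy in norm, so completeness
  suffices and weak compactness is avoided.\<close>

lemma tikhonov_min_exists:
  fixes g :: "'a::{real_inner, complete_space} \<Rightarrow> real"
  assumes g: "convex_on UNIV g" "continuous_on UNIV g" and e: "e > 0"
    and bdd: "\<And>y. m \<le> tikhonov g e y"
  shows "\<exists>x. \<forall>y. tikhonov g e x \<le> tikhonov g e y"
proof -
  let ?f = "tikhonov g e"
  define I where "I = (INF y. ?f y)"
  have bb: "bdd_below (range ?f)" using bdd by (auto intro!: bdd_belowI)
  have I: "I \<le> ?f y" for y unfolding I_def by (rule cINF_lower[OF bb]) auto
  have "\<exists>y. ?f y < I + inverse (real (Suc n))" for n
  proof -
    have "Inf (range ?f) < I + inverse (real (Suc n))" unfolding I_def by simp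
    then show ?thesis using cInf_lessD[of "range ?f" "I + inverse (real (Suc n))"] by blast
  qed
  then obtain u where u: "\<And>n. ?f (u n) < I + inverse (real (Suc n))" by metis
  have sq: "(norm (u n - u k))\<^sup>2 \<le> 4 / e * (inverse (real (Suc n)) + inverse (real (Suc k)))" for n k
  proof -
    \<comment> \<open>The midpoint of two almost minimizing points is the competitor; its value is
      at least the infimum, and the quadratic gain has coefficient e / 8.\<close>
    have "I \<le> (1 - 1/2) * ?f (u k) + 1/2 * ?f (u n) - e / 2 * (1/2 * (1 - 1/2)) * (norm (u n - u k))\<^sup>2"
      using I tikhonov_convex_comb[OF g(1), of "1/2" e "u k" "u n"] by (rule order_trans) auto
    then have "e / 8 * (norm (u n - u k))\<^sup>2 \<le> 1/2 * (inverse (real (Suc n)) + inverse (real (Suc k)))"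
      using u[of n] u[of k] by simp
    then have "8 / e * (e / 8 * (norm (u n - u k))\<^sup>2)
        \<le> 8 / e * (1/2 * (inverse (real (Suc n)) + inverse (real (Suc k))))"
      using e by (intro mult_left_mono) auto
    moreover have "8 / e * (e / 8 * (norm (u n - u k))\<^sup>2) = (norm (u n - u k))\<^sup>2" using e by simp
    moreover have "8 / e * (1/2 * r) = 4 / e * r" for r by simp
    ultimately show ?thesis by (simp only:)
  qed
  have "Cauchy u"
  proof (rule metric_CauchyI)
    fix r :: real assume r: "r > 0"
    have "(\<lambda>n. inverse (real (Suc n))) \<longlonglongrightarrow> 0" by (rule LIMSEQ_inverse_real_of_nat)
    then have "\<forall>\<^sub>F n in sequentially. inverse (real (Suc n)) < e * r\<^sup>2 / 8"
      using e r by (intro order_tendstoD(2)) auto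
    then obtain N where N: "\<And>n. n \<ge> N \<Longrightarrow> inverse (real (Suc n)) < e * r\<^sup>2 / 8"
      by (auto simp: eventually_sequentially)
    show "\<exists>M. \<forall>m\<ge>M. \<forall>n\<ge>M. dist (u m) (u n) < r"
    proof (intro exI allI impI)
      fix m n assume mn: "m \<ge> N" "n \<ge> N"
      have "4 / e * (inverse (real (Suc m)) + inverse (real (Suc n))) < 4 / e * (e * r\<^sup>2 / 8 + e * r\<^sup>2 / 8)"
        using N[OF mn(1)] N[OF mn(2)] e by (intro mult_strict_left_mono add_strict_mono) auto
      also have "\<dots> = r\<^sup>2" using e by (simp add: field_simps)
      finally have "(norm (u m - u n))\<^sup>2 < r\<^sup>2" using sq[of m n] by linarith
      then show "dist (u m) (u n) < r" using r by (simp add: dist_norm power_less_imp_less_base)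
    qed
  qed
  then obtain x where x: "u \<longlonglongrightarrow> x" by (auto simp: Cauchy_convergent_iff convergent_def)
  have "continuous_on UNIV ?f" unfolding tikhonov_def by (intro continuous_intros g)
  then have "(\<lambda>n. ?f (u n)) \<longlonglongrightarrow> ?f x"
    using x by (simp add: continuous_on_eq_continuous_at isCont_tendsto_compose)
  moreover have "(\<lambda>n. I + inverse (real (Suc n))) \<longlonglongrightarrow> I + 0"
    by (intro tendsto_intros LIMSEQ_inverse_real_of_nat)
  ultimately have "?f x \<le> I + 0"
    using u by (intro LIMSEQ_le) (auto intro: less_imp_le)
  then show ?thesis using I by (intro exI[of _ x]) (auto intro: order_trans)
qed

text \<open>The Riesz representative is the minimiser of \<open>norm z ^ 2 / 2 - f z\<close>.\<close>

lemma bounded_linear_riesz: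
  fixes f :: "'a::{real_inner, complete_space} \<Rightarrow> real"
  assumes f: "bounded_linear f"
  shows "\<exists>D. f = (\<lambda>h. inner h D)"
proof -
  interpret bounded_linear f by fact
  obtain K where K: "\<And>x. norm (f x) \<le> norm x * K" using bounded by blast
  let ?F = "tikhonov (\<lambda>y. - f y) 1"
  have "convex_on UNIV (\<lambda>y. - f y)" by (simp add: convex_on_def add scaleR)
  moreover have "continuous_on UNIV (\<lambda>y. - f y)"
    by (intro continuous_intros linear_continuous_on f)
  \<comment> \<open>Boundedness of \<open>f\<close> gives f y \<le> K norm y, and completing the
    square in norm y bounds the functional from below.\<close>
  moreover have "- (K\<^sup>2 / 2) \<le> ?F y" for y
  proof -
    have "0 \<le> (norm y - K)\<^sup>2" by simp
    then have "norm y * K \<le> K\<^sup>2 / 2 + (norm y)\<^sup>2 / 2" by (simp add: power2_eq_square algebra_simps)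
    moreover have "f y \<le> norm y * K" using K[of y] by simp
    ultimately show ?thesis by (simp add: tikhonov_def)
  qed
  ultimately have "\<exists>x. \<forall>y. ?F x \<le> ?F y"
    by (intro tikhonov_min_exists[where m = "- (K\<^sup>2 / 2)"]) auto
  then obtain D where D: "\<And>y. ?F D \<le> ?F y" by blast
  have "f h = inner h D" for h
  proof -
    \<comment> \<open>The variation of the functional from \<open>D\<close> in the direction
      \<open>h\<close> is a quadratic in \<open>s\<close> that vanishes at 0 and is nowhere
      negative, so its derivative at 0 is zero; this is the required identity.\<close>
    have ineq: "0 \<le> inner h D * s + s\<^sup>2 * ((norm h)\<^sup>2 / 2) - s * f h" for s
    proof -
      have "(norm (D + s *\<^sub>R h))\<^sup>2 = (norm D)\<^sup>2 + 2 * s * inner h D + s\<^sup>2 * (norm h)\<^sup>2"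
        by (simp only: power2_norm_eq_inner) (simp add: inner_commute algebra_simps power2_eq_square)
      then show ?thesis
        using D[of "D + s *\<^sub>R h"] by (simp add: tikhonov_def add scaleR algebra_simps)
    qed
    have "((\<lambda>s. inner h D * s + s\<^sup>2 * ((norm h)\<^sup>2 / 2) - s * f h) has_real_derivative inner h D - f h) (at 0)"
      by (auto intro!: derivative_eq_intros)
    then have "inner h D - f h = 0"
      by (rule DERIV_local_min[where d = 1]) (use ineq in auto)
    then show ?thesis by simp
  qed
  then show ?thesis by blast
qed

text \<open>Justifies the definite description in \<open>grad\<close>: Riesz representation gives
  existence, and testing two candidates with their difference gives uniqueness.\<close>

lemma has_gderiv_grad:
  fixes g :: "'a::{real_inner, complete_space} \<Rightarrow> real"
  assumes "g differentiable (at x)"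
  shows "GDERIV g x :> grad g x"
proof -
  obtain f where f: "(g has_derivative f) (at x)" using assms by (auto simp: differentiable_def)
  obtain D where "f = (\<lambda>h. inner h D)"
    using bounded_linear_riesz[OF has_derivative_bounded_linear[OF f]] by (elim exE)
  with f have D: "GDERIV g x :> D" by (simp add: gderiv_def)
  have "D' = D" if "GDERIV g x :> D'" for D'
  proof -
    have "(\<lambda>h. inner h D') = (\<lambda>h. inner h D)"
      using that D unfolding gderiv_def by (rule has_derivative_unique)
    then have "inner (D' - D) D' = inner (D' - D) D" by (rule fun_cong)
    then have "inner (D' - D) (D' - D) = 0" by (simp add: inner_diff_right)
    then show ?thesis by simp
  qed
  with D show ?thesis unfolding grad_def by (rule theI)
qed

lemma convex_on_grad:
  fixes g :: "'a::{real_inner, complete_space} \<Rightarrow> real"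
  assumes g: "convex_on UNIV g" and d: "g differentiable (at y)"
  shows "g y + inner (grad g y) (z - y) \<le> g z"
proof -
  define h where "h = (\<lambda>s. g (y + s *\<^sub>R (z - y)))"
  have "(h has_derivative (\<lambda>s. inner (s *\<^sub>R (z - y)) (grad g y))) (at 0)"
    unfolding h_def
  proof (rule has_derivative_compose[where g = g and f = "\<lambda>s. y + s *\<^sub>R (z - y)"])
    show "((\<lambda>s. y + s *\<^sub>R (z - y)) has_derivative (\<lambda>s. s *\<^sub>R (z - y))) (at 0)"
      by (auto intro!: derivative_eq_intros)
    show "(g has_derivative (\<lambda>h. inner h (grad g y))) (at (y + 0 *\<^sub>R (z - y)))"
      using has_gderiv_grad[OF d] by (simp add: gderiv_def)
  qed
  then have "(h has_real_derivative inner (grad g y) (z - y)) (at 0)"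
    by (rule has_derivative_imp_has_field_derivative) (simp add: inner_commute)
  then have "((\<lambda>s. (h s - h 0) / (s - 0)) \<longlongrightarrow> inner (grad g y) (z - y)) (at 0)"
    by (simp add: has_field_derivative_iff)
  then have "((\<lambda>s. (h s - h 0) / (s - 0)) \<longlongrightarrow> inner (grad g y) (z - y)) (at_right 0)"
    by (rule tendsto_mono[rotated]) (simp add: at_le)
  moreover have "\<forall>\<^sub>F s in at_right 0. (h s - h 0) / (s - 0) \<le> g z - g y"
  proof (rule eventually_mono[OF eventually_at_right_real[OF zero_less_one]])
    fix s :: real assume s: "s \<in> {0<..<1}"
    have "h s = g ((1 - s) *\<^sub>R y + s *\<^sub>R z)" by (simp add: h_def algebra_simps)
    also have "\<dots> \<le> (1 - s) * g y + s * g z"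
      using g s by (intro convex_onD) auto
    finally show "(h s - h 0) / (s - 0) \<le> g z - g y"
      using s by (simp add: h_def field_simps)
  qed
  ultimately have "inner (grad g y) (z - y) \<le> g z - g y"
    by (intro tendsto_upperbound) auto
  then show ?thesis by simp
qed

section \<open>The curve of regularized minimizers and its limit\<close>

locale tikhonov_problem =
  fixes g :: "'a::{real_inner, complete_space} \<Rightarrow> real"
  assumes g_convex: "convex_on UNIV g"
    and g_continuous: "continuous_on UNIV g"
    and g_argmin: "argmin_set g \<noteq> {}"
begin

lemma argmin_le: "z \<in> argmin_set g \<Longrightarrow> g z \<le> g y"
  by (auto simp: argmin_set_def is_arg_min_def not_less)

lemma tikhonov_min_le:
  assumes "e > 0"
  shows "tikhonov g e (tikhonov_min g e) \<le> tikhonov g e y"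
proof -
  obtain z where z: "z \<in> argmin_set g" using g_argmin by auto
  have "g z \<le> tikhonov g e y" for y
    using argmin_le[OF z, of y] assms by (simp add: tikhonov_def add_increasing2)
  then obtain x where x: "\<And>y. tikhonov g e x \<le> tikhonov g e y"
    using tikhonov_min_exists[OF g_convex g_continuous assms] by blast
  then have "is_arg_min (tikhonov g e) (\<lambda>_. True) x" by (auto simp: is_arg_min_def not_less)
  then have "is_arg_min (tikhonov g e) (\<lambda>_. True) (tikhonov_min g e)"
    unfolding tikhonov_min_def arg_min_def by (rule someI)
  then show ?thesis by (auto simp: is_arg_min_def not_less)
qed

lemma tikhonov_min_gap:
  assumes "e > 0"
  shows "tikhonov g e (tikhonov_min g e) + e / 2 * (norm (z - tikhonov_min g e))\<^sup>2 \<le> tikhonov g e z"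
  by (rule tikhonov_min_strong[OF g_convex assms tikhonov_min_le[OF assms]])

lemma tikhonov_min_dist_argmin:
  assumes e: "e > 0" and z: "z \<in> argmin_set g"
  shows "(norm (tikhonov_min g e - z))\<^sup>2 \<le> (norm z)\<^sup>2 - (norm (tikhonov_min g e))\<^sup>2"
proof -
  have "e / 2 * ((norm (z - tikhonov_min g e))\<^sup>2 + (norm (tikhonov_min g e))\<^sup>2) \<le> e / 2 * (norm z)\<^sup>2"
    using tikhonov_min_gap[OF e, of z] argmin_le[OF z, of "tikhonov_min g e"]
    by (simp add: tikhonov_def algebra_simps)
  then show ?thesis using e by (simp add: norm_minus_commute)
qed

lemma norm_tikhonov_min_le:
  assumes e: "e > 0" and z: "z \<in> argmin_set g"
  shows "norm (tikhonov_min g e) \<le> norm z"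
proof (rule power2_le_imp_le)
  show "(norm (tikhonov_min g e))\<^sup>2 \<le> (norm z)\<^sup>2"
    using tikhonov_min_dist_argmin[OF assms] zero_le_power2[of "norm (tikhonov_min g e - z)"] by linarith
qed simp

text \<open>Each minimizer serves as competitor for the other; in the sum of the two strong
  minimality inequalities the values of \<open>g\<close> cancel. In particular the norm of the
  minimizer does not decrease as the parameter decreases.\<close>

lemma tikhonov_min_dist_sq:
  assumes "0 < e'" "e' \<le> e"
  shows "(e + e') * (norm (tikhonov_min g e - tikhonov_min g e'))\<^sup>2
    \<le> (e - e') * ((norm (tikhonov_min g e'))\<^sup>2 - (norm (tikhonov_min g e))\<^sup>2)"
  using tikhonov_min_gap[of e "tikhonov_min g e'"] tikhonov_min_gap[of e' "tikhonov_min g e"] assms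
  by (simp add: tikhonov_def norm_minus_commute field_simps)

text \<open>The difference of squared norms in \<open>tikhonov_min_dist_sq\<close> is factored, the
  sum of norms bounded by 2 norm z, and one factor of the distance cancelled. For the parameter a
  t^(-p) this means that the minimizer moves with speed at most 2 p norm z / t.\<close>

lemma tikhonov_min_lipschitz:
  assumes e: "0 < e" "0 < e'" and z: "z \<in> argmin_set g"
  shows "norm (tikhonov_min g e - tikhonov_min g e') \<le> 2 * norm z * \<bar>e - e'\<bar> / e"
proof -
  have *: "(e + e') * norm (tikhonov_min g e - tikhonov_min g e') \<le> (e - e') * (2 * norm z)"
    if e: "0 < e'" "e' \<le> e" for e e'
  proof (cases "tikhonov_min g e = tikhonov_min g e'")
    case False
    let ?r = "norm (tikhonov_min g e - tikhonov_min g e')"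
    have r: "?r > 0" using False by simp
    have d: "norm (tikhonov_min g e') - norm (tikhonov_min g e) \<le> ?r"
      by (metis norm_minus_commute norm_triangle_ineq2)
    have n: "norm (tikhonov_min g e') + norm (tikhonov_min g e) \<le> 2 * norm z"
      using norm_tikhonov_min_le[OF _ z, of e] norm_tikhonov_min_le[OF _ z, of e'] e by linarith
    have "(norm (tikhonov_min g e'))\<^sup>2 - (norm (tikhonov_min g e))\<^sup>2
        = (norm (tikhonov_min g e') + norm (tikhonov_min g e)) * (norm (tikhonov_min g e') - norm (tikhonov_min g e))"
      by (simp add: power2_eq_square algebra_simps)
    also have "\<dots> \<le> (norm (tikhonov_min g e') + norm (tikhonov_min g e)) * ?r"
      using d by (intro mult_left_mono) auto
    also have "\<dots> \<le> (2 * norm z) * ?r"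
      using n by (intro mult_right_mono) auto
    finally have *: "(norm (tikhonov_min g e'))\<^sup>2 - (norm (tikhonov_min g e))\<^sup>2 \<le> (2 * norm z) * ?r" .
    have "(e + e') * ?r\<^sup>2 \<le> (e - e') * ((2 * norm z) * ?r)"
      using tikhonov_min_dist_sq[OF e]
      by (rule order_trans) (use e * in \<open>intro mult_left_mono, auto\<close>)
    then have "?r * ((e + e') * ?r) \<le> ?r * ((e - e') * (2 * norm z))"
      by (simp add: power2_eq_square algebra_simps)
    then show ?thesis using r by simp
  qed (use that in simp)
  have "(e + e') * norm (tikhonov_min g e - tikhonov_min g e') \<le> \<bar>e - e'\<bar> * (2 * norm z)"
    using *[of e' e] *[of e e'] e by (cases "e' \<le> e") (auto simp: norm_minus_commute add.commute)
  moreover have "e * norm (tikhonov_min g e - tikhonov_min g e') \<le> (e + e') * norm (tikhonov_min g e - tikhonov_min g e')"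
    using e by (intro mult_right_mono) auto
  ultimately have "e * norm (tikhonov_min g e - tikhonov_min g e') \<le> \<bar>e - e'\<bar> * (2 * norm z)" by linarith
  then show ?thesis using e by (simp add: field_simps)
qed

lemma tikhonov_min_value_diff:
  assumes e: "0 < e'" "e' \<le> e" and z: "z \<in> argmin_set g"
  shows "tikhonov g e (tikhonov_min g e) - tikhonov g e' (tikhonov_min g e') \<le> (e - e') / 2 * (norm z)\<^sup>2"
proof -
  have "tikhonov g e (tikhonov_min g e) \<le> tikhonov g e (tikhonov_min g e')"
    using e by (intro tikhonov_min_le) auto
  moreover have "tikhonov g e (tikhonov_min g e') - tikhonov g e' (tikhonov_min g e')
      = (e - e') / 2 * (norm (tikhonov_min g e'))\<^sup>2"
    by (simp add: tikhonov_def field_simps)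
  moreover have "(e - e') / 2 * (norm (tikhonov_min g e'))\<^sup>2 \<le> (e - e') / 2 * (norm z)\<^sup>2"
    using e norm_tikhonov_min_le[OF e(1) z] by (intro mult_left_mono power_mono) auto
  ultimately show ?thesis by linarith
qed

lemma tikhonov_min_isCont:
  assumes e: "e > 0"
  shows "isCont (tikhonov_min g) e"
proof -
  obtain z where z: "z \<in> argmin_set g" using g_argmin by auto
  have "\<forall>\<^sub>F s in at e. 0 < s"
    using e by (rule order_tendstoD(1)[OF tendsto_ident_at])
  then have "\<forall>\<^sub>F s in at e. norm (tikhonov_min g s - tikhonov_min g e) \<le> 2 * norm z * \<bar>e - s\<bar> / e"
  proof eventually_elim
    case (elim s)
    then show ?case using tikhonov_min_lipschitz[OF e _ z, of s] by (simp add: norm_minus_commute)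
  qed
  moreover have "((\<lambda>s. 2 * norm z * \<bar>e - s\<bar> / e) \<longlongrightarrow> 2 * norm z * \<bar>e - e\<bar> / e) (at e)"
    using e by (intro tendsto_intros) auto
  then have "((\<lambda>s. 2 * norm z * \<bar>e - s\<bar> / e) \<longlongrightarrow> 0) (at e)" by simp
  ultimately have "((\<lambda>s. tikhonov_min g s - tikhonov_min g e) \<longlongrightarrow> 0) (at e)"
    by (rule Lim_null_comparison)
  then show ?thesis unfolding isCont_def by (rule LIM_zero_cancel)
qed

text \<open>Along the parameters 1 / (n + 1) the squared norms increase and are bounded, and by
  \<open>inc\<close> the squared distances are at most their increments. The sequence is thus Cauchy
  in norm. Its limit minimizes \<open>g\<close> and inherits the bound by the norm of every other
  minimizer.\<close>

lemma tikhonov_min_tendsto: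
  assumes e: "(e \<longlongrightarrow> 0) F" "\<forall>\<^sub>F t in F. e t > 0"
  shows "((\<lambda>t. tikhonov_min g (e t)) \<longlongrightarrow> min_norm_minimizer g) F"
proof -
  obtain z0 where z0: "z0 \<in> argmin_set g" using g_argmin by auto
  let ?X = "\<lambda>n. tikhonov_min g (inverse (real (Suc n)))"
  let ?N = "\<lambda>n. (norm (?X n))\<^sup>2"
  have pos: "inverse (real (Suc n)) > 0" for n by simp
  have le: "inverse (real (Suc m)) \<le> inverse (real (Suc n))" if "n \<le> m" for n m
    using that by (intro le_imp_inverse_le) auto
  have inc: "(norm (tikhonov_min g d - tikhonov_min g d'))\<^sup>2 \<le> (norm (tikhonov_min g d'))\<^sup>2 - (norm (tikhonov_min g d))\<^sup>2"
    if "0 < d'" "d' \<le> d" for d d'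
  proof (cases "d' = d")
    case False
    let ?a = "(norm (tikhonov_min g d - tikhonov_min g d'))\<^sup>2"
    have h: "(d + d') * ?a \<le> (d - d') * ((norm (tikhonov_min g d'))\<^sup>2 - (norm (tikhonov_min g d))\<^sup>2)"
      using tikhonov_min_dist_sq[OF that] .
    have "(d - d') * ?a \<le> (d + d') * ?a" using that by (intro mult_right_mono) auto
    with h have "(d - d') * ?a \<le> (d - d') * ((norm (tikhonov_min g d'))\<^sup>2 - (norm (tikhonov_min g d))\<^sup>2)" by linarith
    then show ?thesis using that False by simp
  qed simp
  have "incseq ?N"
  proof (rule incseq_SucI)
    fix n show "?N n \<le> ?N (Suc n)"
      using inc[OF pos le[of n "Suc n"]] zero_le_power2[of "norm (?X n - ?X (Suc n))"] by linarith
  qed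
  moreover have "?N n \<le> (norm z0)\<^sup>2" for n
    using norm_tikhonov_min_le[OF pos z0] by (intro power_mono) auto
  ultimately obtain L where L: "?N \<longlonglongrightarrow> L" "\<And>n. ?N n \<le> L"
    using incseq_convergent[of ?N "(norm z0)\<^sup>2"] by blast
  have "Cauchy ?X"
  proof (rule metric_CauchyI)
    fix r :: real assume r: "r > 0"
    then have "\<forall>\<^sub>F n in sequentially. ?N n > L - r\<^sup>2"
      using L(1) by (intro order_tendstoD(1)) auto
    then obtain N where N: "\<And>n. n \<ge> N \<Longrightarrow> ?N n > L - r\<^sup>2" by (auto simp: eventually_sequentially)
    have lt: "dist (?X m) (?X n) < r" if "N \<le> n" "n \<le> m" for m n
    proof -
      have "(norm (?X n - ?X m))\<^sup>2 < r\<^sup>2"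
        using inc[OF pos le[OF that(2)]] N[OF that(1)] L(2)[of m] by linarith
      then show ?thesis using r by (simp add: dist_norm norm_minus_commute power_less_imp_less_base)
    qed
    show "\<exists>M. \<forall>m\<ge>M. \<forall>n\<ge>M. dist (?X m) (?X n) < r"
    proof (intro exI allI impI)
      fix m n assume "m \<ge> N" "n \<ge> N"
      then show "dist (?X m) (?X n) < r"
        using lt[of n m] lt[of m n] by (cases "n \<le> m") (auto simp: dist_commute)
    qed
  qed
  then obtain X where X: "?X \<longlonglongrightarrow> X" by (auto simp: Cauchy_convergent_iff convergent_def)
  have Xz: "norm X \<le> norm z" if "z \<in> argmin_set g" for z
    by (rule tendsto_upperbound[OF tendsto_norm[OF X]])
      (auto intro!: always_eventually norm_tikhonov_min_le[OF pos that] simp del: of_nat_Suc)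
  have "g X \<le> g y" for y
  proof -
    have "g (?X n) \<le> g z0 + inverse (real (Suc n)) / 2 * (norm z0)\<^sup>2" for n
    proof -
      have "0 \<le> inverse (real (Suc n)) / 2 * (norm (?X n))\<^sup>2" by simp
      then show ?thesis using tikhonov_min_le[OF pos, of n z0] by (simp only: tikhonov_def)
    qed
    moreover have "(\<lambda>n. g (?X n)) \<longlonglongrightarrow> g X"
      by (rule isCont_tendsto_compose[OF _ X])
        (use g_continuous in \<open>simp add: continuous_on_eq_continuous_at\<close>)
    moreover have "(\<lambda>n. g z0 + inverse (real (Suc n)) / 2 * (norm z0)\<^sup>2) \<longlonglongrightarrow> g z0 + 0 / 2 * (norm z0)\<^sup>2"
      by (intro tendsto_intros LIMSEQ_inverse_real_of_nat) auto
    ultimately have "g X \<le> g z0 + 0 / 2 * (norm z0)\<^sup>2" by (intro LIMSEQ_le) auto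
    then have "g X \<le> g z0" by simp
    then show ?thesis using argmin_le[OF z0] order_trans by blast
  qed
  then have Xmin: "X \<in> argmin_set g" by (auto simp: argmin_set_def is_arg_min_def not_less)
  \<comment> \<open>\<open>min_norm_minimizer\<close> is a choice, so uniqueness has to be supplied:
    any minimizer of norm at most norm X is the limit of the same sequence and hence equals
    \<open>X\<close>.\<close>
  have ucvg: "?X \<longlonglongrightarrow> z" if z: "z \<in> argmin_set g" "norm z \<le> norm X" for z
  proof -
    have "(\<lambda>n. (norm z)\<^sup>2 - ?N n) \<longlonglongrightarrow> (norm z)\<^sup>2 - (norm X)\<^sup>2"
      by (intro tendsto_intros X)
    moreover have "norm z = norm X" using z Xz by (simp add: order_antisym)
    ultimately have lim: "(\<lambda>n. (norm z)\<^sup>2 - ?N n) \<longlonglongrightarrow> 0" by simp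
    have "(\<lambda>n. (norm (?X n - z))\<^sup>2) \<longlonglongrightarrow> 0"
      by (rule tendsto_sandwich[OF _ _ tendsto_const lim])
        (auto intro!: always_eventually tikhonov_min_dist_argmin z pos simp del: of_nat_Suc)
    then have "(\<lambda>n. norm (?X n - z)) \<longlonglongrightarrow> 0"
      using tendsto_real_sqrt[of "\<lambda>n. (norm (?X n - z))\<^sup>2" 0] by simp
    then show ?thesis by (simp add: LIM_zero_cancel tendsto_norm_zero_iff)
  qed
  have am: "is_arg_min norm (\<lambda>z. z \<in> argmin_set g) X"
    using Xmin Xz by (auto simp: is_arg_min_def not_less)
  then have "is_arg_min norm (\<lambda>z. z \<in> argmin_set g) (min_norm_minimizer g)"
    unfolding min_norm_minimizer_def arg_min_def by (rule someI)
  then have mm: "min_norm_minimizer g \<in> argmin_set g" "norm (min_norm_minimizer g) \<le> norm X"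
    using Xmin by (auto simp: is_arg_min_def not_less)
  have eq: "min_norm_minimizer g = X"
    using LIMSEQ_unique[OF ucvg[OF mm] X] .
  have "((\<lambda>t. norm (tikhonov_min g (e t) - X)) \<longlongrightarrow> 0) F"
  proof (rule tendstoI)
    fix r :: real assume r: "r > 0"
    have "(\<lambda>n. (norm X)\<^sup>2 - ?N n) \<longlonglongrightarrow> (norm X)\<^sup>2 - (norm X)\<^sup>2"
      by (intro tendsto_intros X)
    then have "\<forall>\<^sub>F n in sequentially. (norm X)\<^sup>2 - ?N n < r\<^sup>2"
      using r by (intro order_tendstoD(2)) auto
    then obtain n where n: "(norm X)\<^sup>2 - ?N n < r\<^sup>2"
      by (auto simp: eventually_sequentially)
    have "\<forall>\<^sub>F t in F. e t < inverse (real (Suc n))"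
      by (rule order_tendstoD(2)[OF e(1) pos])
    with e(2) show "\<forall>\<^sub>F t in F. dist (norm (tikhonov_min g (e t) - X)) 0 < r"
    proof eventually_elim
      case (elim t)
      \<comment> \<open>Monotonicity of the norm transfers the estimate from the sequence to all
        smaller parameters, so an arbitrary filter can be treated without passing to
        subsequences.\<close>
      have "?N n \<le> (norm (tikhonov_min g (e t)))\<^sup>2"
        using inc[of "e t" "inverse (real (Suc n))"] elim zero_le_power2[of "norm (?X n - tikhonov_min g (e t))"]
        by linarith
      then have "(norm (tikhonov_min g (e t) - X))\<^sup>2 < r\<^sup>2"
        using tikhonov_min_dist_argmin[OF elim(1) Xmin] n by linarith
      then show ?case using r by (simp add: power_less_imp_less_base)
    qed
  qed
  then show ?thesis unfolding eq by (simp add: LIM_zero_cancel tendsto_norm_zero_iff)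
qed

end

section \<open>Dissipation of the energy\<close>

lemma young_ineq:
  fixes A B u :: real
  assumes "A > 0"
  shows "B * u \<le> A * u\<^sup>2 + B\<^sup>2 / (4 * A)"
proof -
  have "0 \<le> (2 * A * u - B)\<^sup>2" by simp
  then have "4 * A * (B * u) \<le> 4 * A * (A * u\<^sup>2 + B\<^sup>2 / (4 * A))"
    using assms by (simp add: power2_eq_square algebra_simps)
  then show ?thesis using assms by simp
qed

text \<open>Vector algebra at one instant. \<open>r\<close> stands for y - x_t, so that
  \<open>w\<close> is x - x_t; \<open>b'\<close> and \<open>C'\<close> are the derivatives of b and
  of c s; \<open>G\<close> is the gap and \<open>l\<close> the speed bound for the moving minimizer.
  \<open>co1\<close> and \<open>co3\<close> make the coefficients of the two indefinite products
  \<open>inner N v\<close> and \<open>inner v w\<close> small, and \<open>co2\<close> keeps the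
  friction near 2 c s.\<close>

lemma dissipation_estimate:
  fixes v N r :: "'a::real_inner" and b b' c s e d C' G l :: real
  defines "w \<equiv> r - b *\<^sub>R v" and "v' \<equiv> - d *\<^sub>R v - N"
  assumes pos: "b > 0" "c > 0" "s > 0" "e > 0"
    and co1: "(b' - b * d + c * s * b)\<^sup>2 \<le> c / 4 * b * s"
    and co2: "d \<ge> 15 / 8 * c * s"
    and co3: "(C' - c * s * d + 2 * c\<^sup>2 * s\<^sup>2)\<^sup>2 \<le> c\<^sup>2 * s\<^sup>2 * e / 32"
    and co4: "e * b\<^sup>2 \<le> 1 / 4"
    and gap: "G + e / 2 * (norm r)\<^sup>2 \<le> inner N r"
  shows "inner N ((1 + b') *\<^sub>R v + b *\<^sub>R v') + inner v v' + C' * inner v w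
      + c * s * (inner v v + inner v' w) + 2 * c\<^sup>2 * s\<^sup>2 * inner v w
      + l * (c * s * norm v + 2 * c\<^sup>2 * s\<^sup>2 * norm w)
    \<le> - b / 2 * (norm N)\<^sup>2 - c * s * G - 3 / 8 * c * s * (norm v)\<^sup>2 - c / 8 * s * e * (norm w)\<^sup>2
      + (2 * l\<^sup>2 * c * s + 16 * l\<^sup>2 * c ^ 3 * s ^ 3 / e)"
proof -
  define k1 where "k1 = b' - b * d + c * s * b"
  define k3 where "k3 = C' - c * s * d + 2 * c\<^sup>2 * s\<^sup>2"
  have eq: "inner N ((1 + b') *\<^sub>R v + b *\<^sub>R v') + inner v v' + C' * inner v w
      + c * s * (inner v v + inner v' w) + 2 * c\<^sup>2 * s\<^sup>2 * inner v w
    = - b * (norm N)\<^sup>2 + k1 * inner N v - (d - c * s) * (norm v)\<^sup>2 + k3 * inner v w - c * s * inner N r"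
    unfolding k1_def k3_def v'_def w_def power2_norm_eq_inner
    by (simp add: inner_simps inner_commute algebra_simps)
  have i1: "k1 * inner N v \<le> b / 2 * (norm N)\<^sup>2 + c / 8 * s * (norm v)\<^sup>2"
  proof -
    have "k1 * inner N v \<le> \<bar>k1\<bar> * \<bar>inner N v\<bar>" by (metis abs_ge_self abs_mult)
    also have "\<dots> \<le> \<bar>k1\<bar> * (norm N * norm v)"
      by (intro mult_left_mono Cauchy_Schwarz_ineq2) auto
    also have "\<dots> = (\<bar>k1\<bar> * norm v) * norm N" by simp
    also have "\<dots> \<le> b / 2 * (norm N)\<^sup>2 + (\<bar>k1\<bar> * norm v)\<^sup>2 / (4 * (b / 2))"
      using pos by (intro young_ineq) auto
    also have "(\<bar>k1\<bar> * norm v)\<^sup>2 / (4 * (b / 2)) = k1\<^sup>2 / (2 * b) * (norm v)\<^sup>2"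
      by (simp add: power_mult_distrib)
    also have "k1\<^sup>2 / (2 * b) * (norm v)\<^sup>2 \<le> c / 8 * s * (norm v)\<^sup>2"
    proof (rule mult_right_mono)
      have "k1\<^sup>2 \<le> c / 8 * s * (2 * b)" using co1 by (simp add: k1_def algebra_simps)
      then show "k1\<^sup>2 / (2 * b) \<le> c / 8 * s" using pos by (subst pos_divide_le_eq) auto
    qed simp
    finally show ?thesis by simp
  qed
  have i2: "(d - c * s) * (norm v)\<^sup>2 \<ge> 7 / 8 * c * s * (norm v)\<^sup>2"
    using co2 by (intro mult_right_mono) auto
  have i3: "k3 * inner v w \<le> c / 8 * s * (norm v)\<^sup>2 + c / 16 * s * e * (norm w)\<^sup>2"
  proof -
    have "k3 * inner v w \<le> \<bar>k3\<bar> * \<bar>inner v w\<bar>" by (metis abs_ge_self abs_mult)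
    also have "\<dots> \<le> \<bar>k3\<bar> * (norm v * norm w)"
      by (intro mult_left_mono Cauchy_Schwarz_ineq2) auto
    also have "\<dots> = (\<bar>k3\<bar> * norm w) * norm v" by simp
    also have "\<dots> \<le> c * s / 8 * (norm v)\<^sup>2 + (\<bar>k3\<bar> * norm w)\<^sup>2 / (4 * (c * s / 8))"
      using pos by (intro young_ineq) auto
    also have "(\<bar>k3\<bar> * norm w)\<^sup>2 / (4 * (c * s / 8)) = k3\<^sup>2 / (c * s / 2) * (norm w)\<^sup>2"
      by (simp add: power_mult_distrib)
    also have "k3\<^sup>2 / (c * s / 2) * (norm w)\<^sup>2 \<le> c / 16 * s * e * (norm w)\<^sup>2"
    proof (rule mult_right_mono)
      have "k3\<^sup>2 \<le> c / 16 * s * e * (c * s / 2)"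
        using co3 by (simp add: k3_def power2_eq_square algebra_simps)
      then show "k3\<^sup>2 / (c * s / 2) \<le> c / 16 * s * e" using pos by (subst pos_divide_le_eq) auto
    qed simp
    finally show ?thesis by simp
  qed
  \<comment> \<open>Convexity yields a gain in norm r, whereas the energy needs one in norm w.
    Splitting w = r - b v turns e / 2 norm r ^ 2 into e / 4 norm w ^ 2, at a cost of at most norm v
    ^ 2 / 8 by \<open>co4\<close>.\<close>
  have i4: "- (c * s) * inner N r \<le> - (c * s) * G - c / 4 * s * e * (norm w)\<^sup>2 + c / 8 * s * (norm v)\<^sup>2"
  proof -
    have "norm w \<le> norm r + norm (b *\<^sub>R v)" unfolding w_def by (rule norm_triangle_ineq4)
    then have "(norm w)\<^sup>2 \<le> (norm r + b * norm v)\<^sup>2" using pos by (intro power_mono) auto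
    also have "\<dots> \<le> 2 * (norm r)\<^sup>2 + 2 * (b * norm v)\<^sup>2"
      using zero_le_power2[of "norm r - b * norm v"] by (simp add: power2_eq_square algebra_simps)
    finally have "e / 4 * (norm w)\<^sup>2 \<le> e / 4 * (2 * (norm r)\<^sup>2 + 2 * (b * norm v)\<^sup>2)"
      using pos by (intro mult_left_mono) auto
    also have "\<dots> = e / 2 * (norm r)\<^sup>2 + e * b\<^sup>2 * ((norm v)\<^sup>2 / 2)"
      by (simp add: power_mult_distrib algebra_simps)
    also have "\<dots> \<le> e / 2 * (norm r)\<^sup>2 + 1 / 4 * ((norm v)\<^sup>2 / 2)"
      using co4 by (intro add_left_mono mult_right_mono) auto
    finally have "G + e / 4 * (norm w)\<^sup>2 - (norm v)\<^sup>2 / 8 \<le> inner N r" using gap by linarith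
    then have "c * s * (G + e / 4 * (norm w)\<^sup>2 - (norm v)\<^sup>2 / 8) \<le> c * s * inner N r"
      using pos by (intro mult_left_mono) auto
    then show ?thesis by (simp add: algebra_simps)
  qed
  have i5: "l * (c * s * norm v) \<le> c / 8 * s * (norm v)\<^sup>2 + 2 * l\<^sup>2 * c * s"
  proof -
    have "(l * c * s) * norm v \<le> c * s / 8 * (norm v)\<^sup>2 + (l * c * s)\<^sup>2 / (4 * (c * s / 8))"
      using pos by (intro young_ineq) auto
    also have "(l * c * s)\<^sup>2 / (4 * (c * s / 8)) = 2 * l\<^sup>2 * c * s"
      using pos by (simp add: power2_eq_square field_simps)
    finally show ?thesis by (simp add: algebra_simps)
  qed
  have i6: "l * (2 * c\<^sup>2 * s\<^sup>2 * norm w) \<le> c / 16 * s * e * (norm w)\<^sup>2 + 16 * l\<^sup>2 * c ^ 3 * s ^ 3 / e"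
  proof -
    have "(l * 2 * c\<^sup>2 * s\<^sup>2) * norm w \<le> c * s * e / 16 * (norm w)\<^sup>2 + (l * 2 * c\<^sup>2 * s\<^sup>2)\<^sup>2 / (4 * (c * s * e / 16))"
      using pos by (intro young_ineq) auto
    also have "(l * 2 * c\<^sup>2 * s\<^sup>2)\<^sup>2 / (4 * (c * s * e / 16)) = 16 * l\<^sup>2 * c ^ 3 * s ^ 3 / e"
      using pos by (simp add: power2_eq_square power3_eq_cube field_simps)
    finally show ?thesis by (simp add: algebra_simps)
  qed
  \<comment> \<open>The budget: of 7/8 \<open>V\<close>, the estimates \<open>i1\<close>,
    \<open>i3\<close>, \<open>i4\<close>, \<open>i5\<close> spend 1/8 each, leaving 3/8; of 1/4
    \<open>W\<close>, \<open>i3\<close> and \<open>i6\<close> spend 1/16 each, leaving 1/8; of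
    \<open>B\<close>, half is spent by \<open>i1\<close>.\<close>
  define V W B where "V = c * s * (norm v)\<^sup>2" and "W = c * s * e * (norm w)\<^sup>2" and "B = b * (norm N)\<^sup>2"
  have "c / 8 * s * (norm v)\<^sup>2 = V / 8" "7 / 8 * c * s * (norm v)\<^sup>2 = 7 / 8 * V"
    "3 / 8 * c * s * (norm v)\<^sup>2 = 3 / 8 * V" "c / 16 * s * e * (norm w)\<^sup>2 = W / 16"
    "c / 8 * s * e * (norm w)\<^sup>2 = W / 8" "c / 4 * s * e * (norm w)\<^sup>2 = W / 4"
    "b / 2 * (norm N)\<^sup>2 = B / 2" "- b / 2 * (norm N)\<^sup>2 = - B / 2" "- b * (norm N)\<^sup>2 = - B"
    "- (c * s) * inner N r = - (c * s * inner N r)" "- (c * s) * G = - (c * s * G)"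
    by (simp_all add: V_def W_def B_def)
  then show ?thesis
    unfolding eq distrib_left[of l] using i1 i2 i3 i4 i5 i6 by simp
qed

lemma inner_has_real_derivative:
  fixes f h :: "real \<Rightarrow> 'a::real_inner"
  assumes "(f has_vector_derivative f') (at t)" "(h has_vector_derivative h') (at t)"
  shows "((\<lambda>s. inner (f s) (h s)) has_real_derivative inner (f t) h' + inner f' (h t)) (at t)"
  unfolding has_real_derivative_iff_has_vector_derivative
  by (rule bounded_bilinear.has_vector_derivative[OF bounded_bilinear_inner assms])

lemma gderiv_compose_curve:
  assumes "GDERIV g (y t) :> D" "(y has_vector_derivative y') (at t)"
  shows "((\<lambda>s. g (y s)) has_real_derivative inner D y') (at t)"
proof -
  have "((\<lambda>s. g (y s)) has_derivative (\<lambda>s. inner (s *\<^sub>R y') D)) (at t)"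
    using assms unfolding gderiv_def has_vector_derivative_def
    by (intro has_derivative_compose[where g = g and f = y])
  then show ?thesis
    by (rule has_derivative_imp_has_field_derivative) (simp add: inner_commute)
qed

text \<open>A product rule for a second factor that is merely continuous. It is meant for factors
  containing norms of curves, which may fail to be differentiable where the curve vanishes.\<close>

lemma DERIV_vanishing_mult:
  fixes f Q :: "real \<Rightarrow> real"
  assumes f: "(f has_real_derivative f') (at t)" "f t = 0" and Q: "isCont Q t"
  shows "((\<lambda>s. f s * Q s) has_real_derivative f' * Q t) (at t)"
proof -
  have "((\<lambda>s. (f s - f t) / (s - t) * Q s) \<longlongrightarrow> f' * Q t) (at t)"
    using f(1) Q unfolding has_field_derivative_iff isCont_def by (intro tendsto_mult)
  then show ?thesis unfolding has_field_derivative_iff using f(2) by simp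
qed

lemma powr_mult_le_eventually:
  fixes A B k l :: real
  assumes "k < l" "B > 0"
  shows "\<forall>\<^sub>F t in at_top. A * t powr k \<le> B * t powr l"
proof -
  have "((\<lambda>t. A * t powr (k - l)) \<longlongrightarrow> A * 0) at_top"
    using assms by (intro tendsto_intros tendsto_neg_powr filterlim_ident) auto
  then have "\<forall>\<^sub>F t in at_top. A * t powr (k - l) < B"
    using assms by (intro order_tendstoD(2)) auto
  then show ?thesis using eventually_gt_at_top[of 0]
  proof eventually_elim
    case (elim t)
    then have "A * t powr (k - l) * t powr l \<le> B * t powr l" by (intro mult_right_mono) auto
    then show ?case using elim by (simp add: powr_diff)
  qed
qed

section \<open>The trajectory and its energy\<close>

locale tikhonov_flow =
  fixes g :: "'a::{real_inner, complete_space} \<Rightarrow> real"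
    and x :: "real \<Rightarrow> 'a" and u0 v0 :: 'a
    and t0 \<alpha> \<beta> \<gamma> q p a :: real
  assumes g_convex: "convex_on UNIV g"
    and g_diff: "\<And>y. g differentiable (at y)"
    and g_lip: "\<And>B. bounded B \<Longrightarrow> \<exists>L. L-lipschitz_on B (grad g)"
    and g_argmin: "argmin_set g \<noteq> {}"
    and t0: "t0 > 0" and alpha: "\<alpha> > 0" and q: "0 < q" "q < 1"
    and gamma_beta: "(\<gamma> > 0) \<or> (\<gamma> = 0 \<and> \<beta> > 0)"
    and a: "a > 0" and p: "q \<le> p" "p < q + 1"
    and p_eq_q: "p = q \<Longrightarrow> \<gamma> > 0 \<Longrightarrow> a \<le> \<alpha> / (2 * \<gamma>)"
    and sol: "DS_solution g t0 \<alpha> q \<gamma> \<beta> (\<lambda>t. a / t powr p) u0 v0 x"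
begin

lemma g_isCont: "isCont g y"
  using g_diff[of y] by (rule differentiable_imp_continuous_within)

sublocale tikhonov_problem g
  by unfold_locales (simp_all add: g_convex g_argmin continuous_on_eq_continuous_at g_isCont)

definition "eps t = a / t powr p"
definition "b t = beta_coeff \<gamma> \<beta> q t"
definition "v = velocity t0 x"
definition "y = shifted t0 \<gamma> \<beta> q x"
definition "X t = tikhonov_min g (eps t)"
definition "w t = x t - X t"
text \<open>The system contains eps x, not eps y. Writing eps x = eps y - eps b v yields the full
  gradient of the regularized function at y and removes eps b from the friction coefficient.\<close>

definition "damp t = \<alpha> / t powr q - eps t * b t"
definition "N t = grad g (y t) + eps t *\<^sub>R y t"
definition "gap t = tikhonov g (eps t) (y t) - tikhonov g (eps t) (X t)"
text \<open>For p = q and \<gamma> > 0 the correction eps b has the same order t^(-q) as the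
  friction and lowers its limit by a \<gamma>; for p > q it is of lower order.\<close>

definition "c = (if p = q then \<alpha> - a * \<gamma> else \<alpha>) / 2"
definition "energy t = gap t + 1/2 * (norm (v t))\<^sup>2 + c * t powr (-q) * inner (v t) (w t)
  + c\<^sup>2 * (t powr (-q))\<^sup>2 * (norm (w t))\<^sup>2"

lemma eps_eq: "eps t = a * t powr (-p)"
  by (simp add: eps_def powr_minus_divide)

lemma b_eq: "b t = \<gamma> + \<beta> * t powr (-q)"
  by (simp add: b_def beta_coeff_def powr_minus_divide)

lemma eps_pos: "t > 0 \<Longrightarrow> eps t > 0"
  using a by (simp add: eps_def)

lemma y_eq: "y t = x t + b t *\<^sub>R v t"
  by (simp add: y_def shifted_def b_def v_def)

text \<open>The restriction on \<open>a\<close> in the case p = q enters here: it keeps the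
  corrected friction positive.\<close>

lemma c_pos: "c > 0"
proof -
  have "a * \<gamma> < \<alpha>" if "p = q"
  proof (cases "\<gamma> > 0")
    case True
    then have "a * \<gamma> \<le> \<alpha> / 2" using p_eq_q[OF that] by (simp add: field_simps)
    then show ?thesis using alpha by simp
  qed (use gamma_beta alpha in auto)
  then show ?thesis using alpha by (simp add: c_def)
qed

lemma p_bounds: "0 < p" "p < 2"
  using p q by auto

lemma at_within_gt: "t > t0 \<Longrightarrow> at t within {t0..} = at t"
  by (rule at_within_interior) (simp add: interior_Ici)

lemma x_deriv_within: "t \<ge> t0 \<Longrightarrow> (x has_vector_derivative v t) (at t within {t0..})"
  using sol unfolding DS_solution_def v_def velocity_def differentiable_on_def
  by (simp add: vector_derivative_works[symmetric])

lemma v_deriv_within: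
  assumes "t \<ge> t0"
  shows "(v has_vector_derivative - damp t *\<^sub>R v t - N t) (at t within {t0..})"
proof -
  have "(v has_vector_derivative velocity t0 v t) (at t within {t0..})"
    using sol assms unfolding DS_solution_def v_def velocity_def[of t0 "velocity t0 x"] differentiable_on_def
    by (simp add: vector_derivative_works[symmetric])
  moreover have "velocity t0 v t + (\<alpha> / t powr q) *\<^sub>R v t + grad g (y t) + eps t *\<^sub>R x t = 0"
    using sol assms unfolding DS_solution_def v_def y_def eps_def by simp
  then have "velocity t0 v t = 0 - (\<alpha> / t powr q) *\<^sub>R v t - grad g (y t) - eps t *\<^sub>R x t"
    by (simp only: eq_diff_eq ac_simps)
  then have "velocity t0 v t = - damp t *\<^sub>R v t - N t"
    by (simp add: damp_def N_def y_eq scaleR_add_right scaleR_left_diff_distrib)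
  ultimately show ?thesis by simp
qed

lemma x_deriv: "t > t0 \<Longrightarrow> (x has_vector_derivative v t) (at t)"
  using x_deriv_within[of t] at_within_gt[of t] by simp

lemma v_deriv: "t > t0 \<Longrightarrow> (v has_vector_derivative - damp t *\<^sub>R v t - N t) (at t)"
  using v_deriv_within[of t] at_within_gt[of t] by simp

lemma b_deriv: "t > 0 \<Longrightarrow> (b has_real_derivative - (\<beta> * q * t powr (-q-1))) (at t)"
  unfolding b_eq[abs_def] by (auto intro!: derivative_eq_intros)

lemma eps_deriv: "t > 0 \<Longrightarrow> (eps has_real_derivative - (p * eps t / t)) (at t)"
  unfolding eps_eq[abs_def] by (auto intro!: derivative_eq_intros simp: powr_diff)

lemma y_deriv:
  assumes "t > t0"
  shows "(y has_vector_derivative (1 + - (\<beta> * q * t powr (-q-1))) *\<^sub>R v t + b t *\<^sub>R (- damp t *\<^sub>R v t - N t)) (at t)"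
proof -
  have "((\<lambda>t. x t + b t *\<^sub>R v t) has_vector_derivative
      v t + (b t *\<^sub>R (- damp t *\<^sub>R v t - N t) + (- (\<beta> * q * t powr (-q-1))) *\<^sub>R v t)) (at t)"
    using assms t0
    by (intro has_vector_derivative_add x_deriv has_vector_derivative_scaleR b_deriv v_deriv) auto
  then show ?thesis by (simp add: y_eq[abs_def] algebra_simps)
qed

lemma continuous_x: "continuous_on {t0..} x"
  using x_deriv_within by (auto intro!: continuous_on_vector_derivative)

lemma continuous_v: "continuous_on {t0..} v"
  using v_deriv_within by (auto intro!: continuous_on_vector_derivative)

lemma continuous_powr: "continuous_on {t0..} (\<lambda>t. t powr k)"
  using t0 by (intro continuous_intros) auto

lemma continuous_b: "continuous_on {t0..} b"
  unfolding b_eq[abs_def] by (intro continuous_intros continuous_powr)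

lemma continuous_eps: "continuous_on {t0..} eps"
  unfolding eps_eq[abs_def] by (intro continuous_intros continuous_powr)

lemma continuous_y: "continuous_on {t0..} y"
  unfolding y_eq[abs_def] by (intro continuous_intros continuous_x continuous_b continuous_v)

lemma grad_isCont: "isCont (grad g) z"
proof -
  obtain L where "L-lipschitz_on (ball z 1) (grad g)" using g_lip bounded_ball by blast
  then have "continuous_on (ball z 1) (grad g)" by (rule lipschitz_on_continuous_on)
  then show ?thesis by (simp add: continuous_on_eq_continuous_at)
qed

lemma continuous_grad_y: "continuous_on {t0..} (\<lambda>t. grad g (y t))"
  by (rule continuous_on_compose2[of UNIV "grad g"])
    (auto simp: continuous_on_eq_continuous_at grad_isCont intro: continuous_y)

lemma continuous_g: "continuous_on {t0..} f \<Longrightarrow> continuous_on {t0..} (\<lambda>t. g (f t))"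
  by (rule continuous_on_compose2[of UNIV g]) (auto intro: g_continuous)

lemma continuous_N: "continuous_on {t0..} N"
  unfolding N_def[abs_def] by (intro continuous_intros continuous_grad_y continuous_eps continuous_y)

lemma continuous_X: "continuous_on {t0..} X"
  unfolding X_def[abs_def]
proof (rule continuous_on_compose2[of "{0<..}" "tikhonov_min g"])
  show "continuous_on {0<..} (tikhonov_min g)"
    by (simp add: continuous_on_eq_continuous_at tikhonov_min_isCont)
  show "eps ` {t0..} \<subseteq> {0<..}" using t0 eps_pos by auto
qed (rule continuous_eps)

lemma continuous_w: "continuous_on {t0..} w"
  unfolding w_def[abs_def] by (intro continuous_intros continuous_x continuous_X)

lemma continuous_gap: "continuous_on {t0..} gap"
  unfolding gap_def[abs_def] tikhonov_def
  by (intro continuous_intros continuous_g continuous_X continuous_y continuous_eps) auto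

lemma continuous_energy: "continuous_on {t0..} energy"
  unfolding energy_def[abs_def]
  by (intro continuous_intros continuous_powr continuous_gap continuous_v continuous_w)

lemma gap_ge: "t > 0 \<Longrightarrow> eps t / 2 * (norm (y t - X t))\<^sup>2 \<le> gap t"
  using tikhonov_min_gap[OF eps_pos, of t "y t"] by (simp add: gap_def X_def)

lemma gap_nonneg: "t > 0 \<Longrightarrow> gap t \<ge> 0"
  using tikhonov_min_le[OF eps_pos, of t "y t"] by (simp add: gap_def X_def)

lemma gap_le_inner:
  assumes "t > 0"
  shows "gap t + eps t / 2 * (norm (y t - X t))\<^sup>2 \<le> inner (N t) (y t - X t)"
proof -
  have "g (y t) + inner (grad g (y t)) (X t - y t) \<le> g (X t)"
    by (rule convex_on_grad[OF g_convex g_diff])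
  moreover have "eps t / 2 * (norm (y t))\<^sup>2 - eps t / 2 * (norm (X t))\<^sup>2 + eps t / 2 * (norm (y t - X t))\<^sup>2
      = eps t * inner (y t) (y t - X t)"
    by (simp add: power2_norm_eq_inner inner_simps inner_commute field_simps)
  ultimately show ?thesis
    by (simp add: gap_def tikhonov_def N_def inner_simps algebra_simps)
qed

lemma energy_ge:
  assumes t: "t > 0"
  shows "gap t + 1/6 * (norm (v t))\<^sup>2 + c\<^sup>2 / 6 * (t powr (-q))\<^sup>2 * (norm (w t))\<^sup>2 \<le> energy t"
    and "energy t \<le> gap t + (norm (v t))\<^sup>2 + 2 * c\<^sup>2 * (t powr (-q))\<^sup>2 * (norm (w t))\<^sup>2"
proof -
  define z where "z = c * t powr (-q) * norm (w t)"
  have z: "c\<^sup>2 * (t powr (-q))\<^sup>2 * (norm (w t))\<^sup>2 = z\<^sup>2" by (simp add: z_def power_mult_distrib)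
  have "\<bar>c * t powr (-q) * inner (v t) (w t)\<bar> = c * t powr (-q) * \<bar>inner (v t) (w t)\<bar>"
    using c_pos by (simp add: abs_mult)
  also have "\<dots> \<le> c * t powr (-q) * (norm (v t) * norm (w t))"
    using c_pos by (intro mult_left_mono Cauchy_Schwarz_ineq2) auto
  also have "\<dots> = norm (v t) * z" by (simp add: z_def)
  finally have i: "\<bar>c * t powr (-q) * inner (v t) (w t)\<bar> \<le> norm (v t) * z" .
  \<comment> \<open>The weight 3/2 is chosen so that the cross term leaves 1/2 - 1/3 = 1/6 of norm v
    ^ 2 and 1 - 3/4 = 1/4 of z^2, both enough for the lower bound; the weight 1 serves the upper
    bound.\<close>
  have "0 \<le> (norm (v t) - 3/2 * z)\<^sup>2" "0 \<le> (norm (v t) - z)\<^sup>2" by simp_all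
  then have sq: "norm (v t) * z \<le> 1/3 * (norm (v t))\<^sup>2 + 3/4 * z\<^sup>2" "norm (v t) * z \<le> 1/2 * (norm (v t))\<^sup>2 + 1/2 * z\<^sup>2"
    by (simp_all add: power2_eq_square algebra_simps)
  have "energy t = gap t + 1/2 * (norm (v t))\<^sup>2 + c * t powr (-q) * inner (v t) (w t) + z\<^sup>2"
    unfolding energy_def z ..
  moreover have "c\<^sup>2 / 6 * (t powr (-q))\<^sup>2 * (norm (w t))\<^sup>2 = z\<^sup>2 / 6"
    "2 * c\<^sup>2 * (t powr (-q))\<^sup>2 * (norm (w t))\<^sup>2 = 2 * z\<^sup>2" using z by simp_all
  moreover have "z\<^sup>2 \<ge> 0" by simp
  ultimately show "gap t + 1/6 * (norm (v t))\<^sup>2 + c\<^sup>2 / 6 * (t powr (-q))\<^sup>2 * (norm (w t))\<^sup>2 \<le> energy t"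
    and "energy t \<le> gap t + (norm (v t))\<^sup>2 + 2 * c\<^sup>2 * (t powr (-q))\<^sup>2 * (norm (w t))\<^sup>2"
    using i sq by linarith+
qed

text \<open>The map \<open>X\<close> is only locally Lipschitz. We differentiate the energy with \<open>X\<close> frozen at its
  current value and bound the error of freezing by a function with a derivative.\<close>

lemma energy_dini:
  assumes t: "t > t0" and z: "z \<in> argmin_set g"
  defines "s \<equiv> t powr (-q)" and "b' \<equiv> - (\<beta> * q * t powr (-q-1))" and "v' \<equiv> - damp t *\<^sub>R v t - N t"
    and "l \<equiv> 2 * norm z * p / t"
  shows "dini_le energy t
    (inner (N t) ((1 + b') *\<^sub>R v t + b t *\<^sub>R v') + inner (v t) v' + (- (q * c * t powr (-q-1))) * inner (v t) (w t)
      + c * s * (inner (v t) (v t) + inner v' (w t)) + 2 * c\<^sup>2 * s\<^sup>2 * inner (v t) (w t)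
      + l * (c * s * norm (v t) + 2 * c\<^sup>2 * s\<^sup>2 * norm (w t)) + p * eps t / t * ((norm z)\<^sup>2 / 2))"
proof -
  have t_pos: "t > 0" using t t0 by simp
  let ?z = "X t" and ?n = "norm z"
  \<comment> \<open>The energy with the minimizer frozen at its value at time \<open>t\<close> and
    without the minimal value of the regularized function.\<close>
  let ?H = "\<lambda>r. g (y r) + eps r / 2 * inner (y r) (y r) + 1/2 * inner (v r) (v r)
    + c * r powr (-q) * inner (v r) (x r - ?z) + c\<^sup>2 * (r powr (-q))\<^sup>2 * inner (x r - ?z) (x r - ?z)"
  \<comment> \<open>Multiplied by \<open>eps t - eps r\<close>, this bounds the change of the
    minimal value (first summand) and the displacement of the minimizer in the mixed and in the
    quadratic term (the rest). The product vanishes at r = t, so only the value of \<open>?Q\<close>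
    at \<open>t\<close> enters the derivative.\<close>
  let ?Q = "\<lambda>r. ?n\<^sup>2 / 2 + (2 * ?n / eps t) * (c * r powr (-q) * norm (v r)
    + c\<^sup>2 * (r powr (-q))\<^sup>2 * (2 * norm (x r - ?z) + 2 * ?n * (eps t - eps r) / eps t))"
  let ?y' = "(1 + b') *\<^sub>R v t + b t *\<^sub>R v'"
  have dy: "(y has_vector_derivative ?y') (at t)"
    using y_deriv[OF t] by (simp add: b'_def v'_def)
  have dv: "(v has_vector_derivative v') (at t)" using v_deriv[OF t] by (simp add: v'_def)
  have dx: "((\<lambda>r. x r - ?z) has_vector_derivative v t) (at t)"
    using has_vector_derivative_diff[OF x_deriv[OF t] has_vector_derivative_const, of ?z] by simp
  have ds: "((\<lambda>r. r powr (-q)) has_real_derivative - (q * t powr (-q-1))) (at t)"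
    using t_pos by (auto intro!: derivative_eq_intros)
  have ds2: "((\<lambda>r. (r powr (-q))\<^sup>2) has_real_derivative 2 * (t powr (-q)) * (- (q * t powr (-q-1)))) (at t)"
    using DERIV_power[OF ds, of 2] by (simp add: mult_ac)
  note d1 = gderiv_compose_curve[OF has_gderiv_grad[OF g_diff] dy]
  note d2 = DERIV_mult'[OF DERIV_cdivide[OF eps_deriv[OF t_pos], of 2] inner_has_real_derivative[OF dy dy]]
  note d3 = DERIV_cmult[OF inner_has_real_derivative[OF dv dv], of "1/2"]
  note d4 = DERIV_mult'[OF DERIV_cmult[OF ds, of c] inner_has_real_derivative[OF dv dx]]
  note d5 = DERIV_mult'[OF DERIV_cmult[OF ds2, of "c\<^sup>2"] inner_has_real_derivative[OF dx dx]]
  have "(?H has_real_derivative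
      inner (grad g (y t)) ?y' + (eps t / 2 * (inner (y t) ?y' + inner ?y' (y t)) + - (p * eps t / t) / 2 * inner (y t) (y t))
      + 1/2 * (inner (v t) v' + inner v' (v t))
      + (c * t powr (-q) * (inner (v t) (v t) + inner v' (x t - ?z)) + c * (- (q * t powr (-q-1))) * inner (v t) (x t - ?z))
      + (c\<^sup>2 * (t powr (-q))\<^sup>2 * (inner (x t - ?z) (v t) + inner (v t) (x t - ?z))
         + c\<^sup>2 * (2 * (t powr (-q)) * (- (q * t powr (-q-1)))) * inner (x t - ?z) (x t - ?z))) (at t)"
    (is "(_ has_real_derivative ?DH) _")
    by (intro DERIV_add d1 d2 d3 d4 d5)
  moreover have "isCont ?Q t"
  proof -
    have "isCont v t" "isCont x t" "isCont eps t"
      using dv x_deriv[OF t] eps_deriv[OF t_pos]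
      by (auto intro: has_vector_derivative_continuous DERIV_isCont)
    then show ?thesis using t_pos eps_pos[OF t_pos] by (intro continuous_intros) auto
  qed
  then have "((\<lambda>r. (eps t - eps r) * ?Q r) has_real_derivative p * eps t / t * ?Q t) (at t)"
    by (intro DERIV_vanishing_mult) (use eps_deriv[OF t_pos] in \<open>auto intro!: derivative_eq_intros\<close>)
  ultimately have "((\<lambda>r. ?H r + (eps t - eps r) * ?Q r) has_real_derivative ?DH + p * eps t / t * ?Q t) (at t)"
    by (rule DERIV_add)
  then have "dini_le energy t (?DH + p * eps t / t * ?Q t)"
  proof (rule dini_le_majorant)
    fix r assume r: "r > t"
    then have r_pos: "r > 0" using t_pos by simp
    have er: "0 < eps r" "eps r \<le> eps t" "eps t > 0"
      using r t_pos p_bounds a eps_pos r_pos by (auto simp: eps_eq intro!: powr_mono2')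
    define k where "k = 2 * ?n * (eps t - eps r) / eps t"
    have k: "norm (?z - X r) \<le> k" "k \<ge> 0"
      using tikhonov_min_lipschitz[OF er(3,1) z] er by (auto simp: X_def k_def)
    have val: "tikhonov g (eps t) ?z - tikhonov g (eps r) (X r) \<le> (eps t - eps r) / 2 * ?n\<^sup>2"
      unfolding X_def by (rule tikhonov_min_value_diff[OF er(1,2) z])
    have "inner (v r) (x r - X r) = inner (v r) (x r - ?z) + inner (v r) (?z - X r)"
      by (simp add: inner_simps)
    also have "inner (v r) (?z - X r) \<le> norm (v r) * norm (?z - X r)" by (rule norm_cauchy_schwarz)
    also have "\<dots> \<le> norm (v r) * k" using k by (intro mult_left_mono) auto
    finally have "c * r powr (-q) * inner (v r) (x r - X r) \<le> c * r powr (-q) * (inner (v r) (x r - ?z) + norm (v r) * k)"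
      using c_pos by (intro mult_left_mono) auto
    moreover have "c\<^sup>2 * (r powr (-q))\<^sup>2 * (norm (x r - X r))\<^sup>2
        \<le> c\<^sup>2 * (r powr (-q))\<^sup>2 * ((norm (x r - ?z))\<^sup>2 + k * (2 * norm (x r - ?z) + k))"
    proof (intro mult_left_mono)
      have "norm (x r - X r) \<le> norm (x r - ?z) + norm (?z - X r)"
        using norm_triangle_ineq[of "x r - ?z" "?z - X r"] by simp
      also have "\<dots> \<le> norm (x r - ?z) + k" using k by simp
      finally have "(norm (x r - X r))\<^sup>2 \<le> (norm (x r - ?z) + k)\<^sup>2" by (intro power_mono) auto
      then show "(norm (x r - X r))\<^sup>2 \<le> (norm (x r - ?z))\<^sup>2 + k * (2 * norm (x r - ?z) + k)"
        by (simp add: power2_eq_square algebra_simps)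
    qed auto
    moreover have "(eps t - eps r) * ?Q r = (eps t - eps r) / 2 * ?n\<^sup>2
        + (c * r powr (-q) * (norm (v r) * k) + c\<^sup>2 * (r powr (-q))\<^sup>2 * (k * (2 * norm (x r - ?z) + k)))"
    proof -
      have gen: "D * (P / 2 + K * W) = D / 2 * P + (D * K) * W" for D P K W :: real
        by (simp add: algebra_simps)
      have k': "(eps t - eps r) * (2 * ?n / eps t) = k" by (simp add: k_def)
      show ?thesis unfolding gen k' k_def[symmetric] by (simp add: algebra_simps)
    qed
    moreover have "energy r = g (y r) + eps r / 2 * (norm (y r))\<^sup>2 - tikhonov g (eps r) (X r) + 1/2 * (norm (v r))\<^sup>2
        + c * r powr (-q) * inner (v r) (x r - X r) + c\<^sup>2 * (r powr (-q))\<^sup>2 * (norm (x r - X r))\<^sup>2"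
      by (simp add: energy_def gap_def w_def tikhonov_def[of g "eps r" "y r"])
    moreover have "energy t = g (y t) + eps t / 2 * (norm (y t))\<^sup>2 - tikhonov g (eps t) ?z + 1/2 * (norm (v t))\<^sup>2
        + c * t powr (-q) * inner (v t) (x t - ?z) + c\<^sup>2 * (t powr (-q))\<^sup>2 * (norm (x t - ?z))\<^sup>2"
      by (simp add: energy_def gap_def w_def tikhonov_def[of g "eps t" "y t"])
    moreover
    have Hn: "?H u = g (y u) + eps u / 2 * (norm (y u))\<^sup>2 + 1/2 * (norm (v u))\<^sup>2
        + c * u powr (-q) * inner (v u) (x u - ?z) + c\<^sup>2 * (u powr (-q))\<^sup>2 * (norm (x u - ?z))\<^sup>2" for u
      by (simp only: power2_norm_eq_inner)
    note Hn[of r] Hn[of t]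
    moreover have "(eps t - eps t) * ?Q t = 0" by simp
    ultimately show "energy r - energy t \<le> (?H r + (eps t - eps r) * ?Q r) - (?H t + (eps t - eps t) * ?Q t)"
      using val distrib_left[of "c * r powr (-q)" "inner (v r) (x r - ?z)" "norm (v r) * k"]
        distrib_left[of "c\<^sup>2 * (r powr (-q))\<^sup>2" "(norm (x r - ?z))\<^sup>2" "k * (2 * norm (x r - ?z) + k)"]
      by linarith
  qed
  \<comment> \<open>The decrease of eps in front of norm y ^ 2 and the decrease of (t^(-q))^2 in
    front of norm w ^ 2 have a favourable sign and are discarded (facts 3 and 4). The factor
    \<open>l\<close> is p eps / t times 2 norm z / eps.\<close>
  moreover have "?DH + p * eps t / t * ?Q t \<le>
      (inner (N t) ?y' + inner (v t) v' + (- (q * c * t powr (-q-1))) * inner (v t) (w t)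
      + c * s * (inner (v t) (v t) + inner v' (w t)) + 2 * c\<^sup>2 * s\<^sup>2 * inner (v t) (w t)
      + l * (c * s * norm (v t) + 2 * c\<^sup>2 * s\<^sup>2 * norm (w t)) + p * eps t / t * ((norm z)\<^sup>2 / 2))"
  proof -
    have e: "eps t > 0" using eps_pos t_pos .
    have 1: "inner (grad g (y t)) ?y' + eps t / 2 * (inner (y t) ?y' + inner ?y' (y t)) = inner (N t) ?y'"
    proof -
      have "A + e / 2 * (B + B) = A + e * B" for A B e :: real by simp
      then show ?thesis
        by (simp only: N_def inner_add_left inner_scaleR_left inner_commute[of _ "y t"])
    qed
    have 2: "p * eps t / t * ?Q t = l * (c * s * norm (v t) + 2 * c\<^sup>2 * s\<^sup>2 * norm (w t)) + p * eps t / t * ((norm z)\<^sup>2 / 2)"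
      using e t_pos by (simp add: l_def s_def w_def field_simps)
    have 3: "p * eps t / t / 2 * inner (y t) (y t) \<ge> 0"
      using e t_pos p_bounds by simp
    have 4: "c\<^sup>2 * (2 * (t powr (-q)) * (q * t powr (-q-1))) * inner (x t - ?z) (x t - ?z) \<ge> 0"
      using q by simp
    have 5: "inner (v t) v' = 1/2 * (inner (v t) v' + inner v' (v t))" by (simp add: inner_commute)
    have 6: "c\<^sup>2 * (t powr (-q))\<^sup>2 * (inner (x t - ?z) (v t) + inner (v t) (x t - ?z)) = 2 * c\<^sup>2 * s\<^sup>2 * inner (v t) (w t)"
      by (simp add: s_def w_def inner_commute)
    have 7: "c * t powr (-q) * (inner (v t) (v t) + inner v' (x t - ?z)) = c * s * (inner (v t) (v t) + inner v' (w t))"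
      by (simp add: s_def w_def)
    have 8: "c * (- (q * t powr (-q-1))) * inner (v t) (x t - ?z) = (- (q * c * t powr (-q-1))) * inner (v t) (w t)"
      by (simp add: w_def)
    show ?thesis using 1 2 3 4 5 6 7 8 by (simp only: mult_minus_left mult_minus_right divide_minus_left)
  qed
  ultimately show ?thesis by (rule dini_le_mono)
qed

end

section \<open>The dissipation inequality and decay of the energy\<close>

context tikhonov_flow begin

text \<open>The order of the error. The exponent p + 1 comes from the derivative of eps; 3 q + 2 - p
  comes from the moving minimizer, whose squared speed t^(-2) appears with s^3 / eps.\<close>

definition "\<sigma> = min (p + 1) (3 * q + 2 - p)"
text \<open>The relative damping rate is t^(-q) for the gap and the velocity, but only eps / t^(-q),
  of order t^(-(p - q)), for the distance part; the slower one decides.\<close>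

definition "\<rho> = max q (p - q)"

definition dissipation :: "real \<Rightarrow> real" where
  "dissipation t = b t / 2 * (norm (N t))\<^sup>2 + c * t powr (-q) * gap t + 3/8 * c * t powr (-q) * (norm (v t))\<^sup>2
    + c / 8 * t powr (-q) * eps t * (norm (w t))\<^sup>2"

lemma b_le: "t \<ge> 1 \<Longrightarrow> \<bar>b t\<bar> \<le> \<gamma> + \<bar>\<beta>\<bar>"
proof -
  assume "t \<ge> 1"
  then have "t powr (-q) \<le> 1" using powr_mono[of "-q" 0 t] q by simp
  then have "\<bar>\<beta>\<bar> * t powr (-q) \<le> \<bar>\<beta>\<bar> * 1" by (intro mult_left_mono) auto
  moreover have "\<bar>b t\<bar> \<le> \<bar>\<gamma>\<bar> + \<bar>\<beta> * t powr (-q)\<bar>" unfolding b_eq by (rule abs_triangle_ineq)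
  moreover have "\<bar>\<beta> * t powr (-q)\<bar> = \<bar>\<beta>\<bar> * t powr (-q)" by (simp add: abs_mult)
  moreover have "\<gamma> \<ge> 0" using gamma_beta by auto
  ultimately show ?thesis by linarith
qed

text \<open>The derivative of \<open>b\<close> is compared with \<open>b\<close> itself, since for
  \<gamma> = 0 an absolute bound would be useless: there b = \<beta> t^(-q), and the claim rests on
  2 q < q + 1.\<close>

lemma eventually_b_pos:
  "\<forall>\<^sub>F t in at_top. b t > 0 \<and> \<bar>\<beta> * q * t powr (-q-1)\<bar> \<le> b t * t powr (-q)"
proof (cases "\<gamma> > 0")
  case True
  have "\<forall>\<^sub>F t in at_top. \<bar>\<beta>\<bar> * t powr (-q) \<le> \<gamma> / 2 * t powr 0"
    "\<forall>\<^sub>F t in at_top. \<bar>\<beta>\<bar> * q * t powr (-q-1) \<le> \<gamma> / 2 * t powr (-q)"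
    using True q by (intro powr_mult_le_eventually; simp)+
  then show ?thesis using eventually_gt_at_top[of 0]
  proof eventually_elim
    case (elim t)
    have "\<bar>\<beta> * t powr (-q)\<bar> \<le> \<gamma> / 2" using elim by (simp add: abs_mult)
    then have b: "b t \<ge> \<gamma> / 2" unfolding b_eq by linarith
    have "\<gamma> / 2 * t powr (-q) \<le> b t * t powr (-q)" using b by (intro mult_right_mono) auto
    moreover have "\<bar>\<beta> * q * t powr (-q-1)\<bar> = \<bar>\<beta>\<bar> * q * t powr (-q-1)"
      using q by (simp add: abs_mult)
    moreover have "b t > 0" using b True by simp
    ultimately show ?case using elim by (intro conjI) linarith+
  qed
next
  case False
  then have g: "\<gamma> = 0" "\<beta> > 0" using gamma_beta by auto
  have "\<forall>\<^sub>F t in at_top. \<beta> * q * t powr (-q-1) \<le> \<beta> * t powr (-q-q)"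
    using g q by (intro powr_mult_le_eventually) auto
  then show ?thesis using eventually_gt_at_top[of 0]
  proof eventually_elim
    case (elim t)
    have b: "b t = \<beta> * t powr (-q)" unfolding b_eq by (simp add: g)
    have "t powr (-q-q) = t powr (-q) * t powr (-q)" using powr_add[of t "-q" "-q"] by simp
    then show ?case using elim g(2) q unfolding b by (simp add: abs_mult mult.assoc)
  qed
qed

lemma damp_estimate:
  assumes "t \<ge> 1"
  shows "\<bar>damp t - 2 * c * t powr (-q)\<bar> \<le> a * (\<gamma> + \<bar>\<beta>\<bar>) * t powr (- (if p = q then 2 * q else p))"
proof (cases "p = q")
  case True
  have "damp t - 2 * c * t powr (-q) = - (a * \<beta> * (t powr (-q) * t powr (-q)))"
  proof -
    have "c = (\<alpha> - a * \<gamma>) / 2" "eps t = a * t powr (-q)" 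
      unfolding c_def eps_eq by (simp_all add: True)
    moreover have "\<alpha> / t powr q = \<alpha> * t powr (-q)" by (simp add: powr_minus_divide)
    moreover have "2 * c' * s = \<alpha> * s - a * \<gamma> * s" if "c' = (\<alpha> - a * \<gamma>) / 2" for c' s
      unfolding that by (simp add: left_diff_distrib)
    ultimately show ?thesis unfolding damp_def b_eq by (simp only: ring_distribs) simp
  qed
  also have "t powr (-q) * t powr (-q) = t powr (- (2 * q))"
    using assms by (simp add: powr_add[symmetric])
  finally have "\<bar>damp t - 2 * c * t powr (-q)\<bar> = a * \<bar>\<beta>\<bar> * t powr (- (2 * q))"
    using a by (simp add: abs_mult)
  also have "\<dots> \<le> a * (\<gamma> + \<bar>\<beta>\<bar>) * t powr (- (2 * q))"
    using a gamma_beta by (intro mult_right_mono mult_left_mono) auto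
  finally show ?thesis using True by simp
next
  case False
  have "damp t - 2 * c * t powr (-q) = - (eps t * b t)"
    using False by (simp add: damp_def c_def powr_minus_divide[of t q])
  then have "\<bar>damp t - 2 * c * t powr (-q)\<bar> = a * t powr (-p) * \<bar>b t\<bar>"
    using a by (simp add: eps_eq abs_mult)
  also have "\<dots> \<le> a * t powr (-p) * (\<gamma> + \<bar>\<beta>\<bar>)"
    using a b_le[OF assms] by (intro mult_left_mono) auto
  finally show ?thesis using False by (simp add: mult_ac)
qed

text \<open>Supplies the coefficient hypotheses of \<open>dissipation_estimate\<close> for large
  times.\<close>

lemma eventually_coefficients:
  "\<forall>\<^sub>F t in at_top. b t > 0
    \<and> (- (\<beta> * q * t powr (-q-1)) - b t * damp t + c * t powr (-q) * b t)\<^sup>2 \<le> c / 4 * b t * t powr (-q)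
    \<and> damp t \<ge> 15 / 8 * c * t powr (-q)
    \<and> (- (q * c * t powr (-q-1)) - c * t powr (-q) * damp t + 2 * c\<^sup>2 * (t powr (-q))\<^sup>2)\<^sup>2
        \<le> c\<^sup>2 * (t powr (-q))\<^sup>2 * eps t / 32
    \<and> eps t * (b t)\<^sup>2 \<le> 1 / 4"
proof -
  define m where "m = (if p = q then 2 * q else p)"
  define B where "B = \<gamma> + \<bar>\<beta>\<bar>"
  \<comment> \<open>\<open>m\<close> is the order of the deviation of the friction from 2 c s. The
    bound q < m makes it small relative to s; p < 2 m makes its square small relative to
    eps.\<close>
  have m: "q < m" "p < 2 * m" using p q by (auto simp: m_def)
  have B: "B \<ge> 0" using gamma_beta by (auto simp: B_def)
  have "\<forall>\<^sub>F t in at_top. a * B * t powr (-m) \<le> c / 8 * t powr (-q)"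
    "\<forall>\<^sub>F t in at_top. (a * B)\<^sup>2 * t powr (- (2 * m)) \<le> a / 128 * t powr (-p)"
    "\<forall>\<^sub>F t in at_top. q\<^sup>2 * t powr (-2) \<le> a / 128 * t powr (-p)"
    "\<forall>\<^sub>F t in at_top. B * (1 + 2 * c)\<^sup>2 * t powr (-q) \<le> c / 4 * t powr 0"
    "\<forall>\<^sub>F t in at_top. a * B\<^sup>2 * t powr (-p) \<le> 1/4 * t powr 0"
    using a c_pos m p_bounds q by (intro powr_mult_le_eventually; simp)+
  then show ?thesis using eventually_b_pos eventually_ge_at_top[of 1]
  proof eventually_elim
    case (elim t)
    define s where "s = t powr (-q)"
    have t: "t > 0" and s: "s > 0" using elim by (auto simp: s_def)
    define \<eta> where "\<eta> = damp t - 2 * c * s"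
    have \<eta>: "\<bar>\<eta>\<bar> \<le> a * B * t powr (-m)"
      using damp_estimate[of t] elim by (simp add: \<eta>_def s_def B_def m_def)
    have \<eta>1: "\<bar>\<eta>\<bar> \<le> c / 8 * s" using \<eta> elim by (simp add: s_def)
    have \<eta>2: "\<eta>\<^sup>2 \<le> eps t / 128"
    proof -
      have "\<eta>\<^sup>2 \<le> (a * B * t powr (-m))\<^sup>2" using \<eta> by (rule power2_le_iff_abs_le[THEN iffD2, rotated]) (use a B in simp)
      also have "\<dots> = (a * B)\<^sup>2 * t powr (- (2 * m))"
        by (simp add: power_mult_distrib power2_eq_square powr_add[symmetric])
      finally show ?thesis using elim by (simp add: eps_eq)
    qed
    have bB: "b t \<le> B" using b_le[of t] elim by (simp add: B_def)
    have b0: "b t > 0" using elim by simp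
    \<comment> \<open>All terms carry the factor b s, so the square is b s times a quantity tending
      to 0. This remains sharp enough when b tends to 0.\<close>
    have C1: "(- (\<beta> * q * t powr (-q-1)) - b t * damp t + c * s * b t)\<^sup>2 \<le> c / 4 * b t * s"
    proof -
      have "- (\<beta> * q * t powr (-q-1)) - b t * damp t + c * s * b t = - (\<beta> * q * t powr (-q-1)) - b t * (c * s + \<eta>)"
        by (simp add: \<eta>_def algebra_simps)
      also have "\<bar>\<dots>\<bar> \<le> \<bar>\<beta> * q * t powr (-q-1)\<bar> + b t * \<bar>c * s + \<eta>\<bar>"
        using b0 abs_triangle_ineq4[of "- (\<beta> * q * t powr (-q-1))" "b t * (c * s + \<eta>)"] by (simp add: abs_mult)
      also have "\<dots> \<le> b t * s + b t * (2 * c * s)"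
      proof (intro add_mono mult_left_mono)
        show "\<bar>\<beta> * q * t powr (-q-1)\<bar> \<le> b t * s" using elim by (simp add: s_def)
        have "c * s > 0" using c_pos s by simp
        then show "\<bar>c * s + \<eta>\<bar> \<le> 2 * c * s" using \<eta>1 by linarith
      qed (use b0 in simp)
      also have "\<dots> = b t * (s * (1 + 2 * c))" by (simp add: algebra_simps)
      finally have "(- (\<beta> * q * t powr (-q-1)) - b t * damp t + c * s * b t)\<^sup>2 \<le> (b t * (s * (1 + 2 * c)))\<^sup>2"
        using b0 s c_pos by (intro power2_le_iff_abs_le[THEN iffD2]) auto
      also have "\<dots> = b t * s * (b t * (1 + 2 * c)\<^sup>2 * s)"
        by (simp add: power_mult_distrib power2_eq_square)
      also have "\<dots> \<le> b t * s * (B * (1 + 2 * c)\<^sup>2 * s)"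
        using bB b0 s by (intro mult_left_mono mult_right_mono) auto
      also have "\<dots> \<le> b t * s * (c / 4)"
        using elim b0 s t by (intro mult_left_mono) (auto simp: s_def)
      finally show ?thesis by (simp add: mult_ac)
    qed
    have C2: "damp t \<ge> 15 / 8 * c * s" 
    proof -
      have "- \<eta> \<le> c * s / 8" using \<eta>1 by (simp add: abs_le_iff)
      then have "2 * (c * s) - damp t \<le> c * s / 8" by (simp add: \<eta>_def)
      then show ?thesis by (simp add: mult_ac)
    qed
    \<comment> \<open>The leading terms cancel because the friction is 2 c s + \<eta>; what is left
      is c s (q / t + \<eta>), and p < 2 makes (q / t)^2 small relative to eps.\<close>
    have C3: "(- (q * c * t powr (-q-1)) - c * s * damp t + 2 * c\<^sup>2 * s\<^sup>2)\<^sup>2 \<le> c\<^sup>2 * s\<^sup>2 * eps t / 32"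
    proof -
      have "t powr (-q-1) = s * (1 / t)" using t by (simp add: s_def powr_diff)
      then have "- (q * c * t powr (-q-1)) - c * s * damp t + 2 * c\<^sup>2 * s\<^sup>2 = - (c * s * (q / t + \<eta>))"
        by (simp add: \<eta>_def power2_eq_square algebra_simps)
      then have "(- (q * c * t powr (-q-1)) - c * s * damp t + 2 * c\<^sup>2 * s\<^sup>2)\<^sup>2 = c\<^sup>2 * s\<^sup>2 * (q / t + \<eta>)\<^sup>2"
        by (simp add: power_mult_distrib)
      also have "\<dots> \<le> c\<^sup>2 * s\<^sup>2 * (eps t / 32)"
      proof (rule mult_left_mono)
        have "(q / t)\<^sup>2 = q\<^sup>2 * t powr (-2)"
          using t by (simp add: power_mult_distrib power_inverse powr_minus powr_numeral divide_inverse)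
        then have "(q / t)\<^sup>2 \<le> eps t / 128" using elim by (simp add: eps_eq)
        moreover have "(q / t + \<eta>)\<^sup>2 \<le> 2 * (q / t)\<^sup>2 + 2 * \<eta>\<^sup>2"
          using zero_le_power2[of "q / t - \<eta>"] by (simp add: power2_diff power2_sum)
        ultimately show "(q / t + \<eta>)\<^sup>2 \<le> eps t / 32" using \<eta>2 by linarith
      qed simp
      finally show ?thesis by simp
    qed
    have C4: "eps t * (b t)\<^sup>2 \<le> 1 / 4"
    proof -
      have "eps t * (b t)\<^sup>2 \<le> eps t * B\<^sup>2"
        using bB b0 eps_pos[OF t] by (intro mult_left_mono power_mono) auto
      also have "\<dots> \<le> 1 / 4" using elim t by (simp add: eps_eq mult_ac)
      finally show ?thesis .
    qed
    show ?case using b0 C1 C2 C3 C4 unfolding s_def by blast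
  qed
qed

lemma energy_dissipation:
  "\<exists>K\<ge>0. \<forall>\<^sub>F t in at_top. dini_le energy t (- dissipation t + K * t powr (-\<sigma>))"
proof -
  obtain z where z: "z \<in> argmin_set g" using g_argmin by auto
  define n where "n = norm z"
  \<comment> \<open>The summands belong, in this order, to the motion of the minimizer in the mixed
    term, to its motion in the quadratic term, and to the decrease of eps.\<close>
  define K where "K = 8 * n\<^sup>2 * p\<^sup>2 * c + 64 * n\<^sup>2 * p\<^sup>2 * c ^ 3 / a + p * a * n\<^sup>2 / 2"
  have "\<forall>\<^sub>F t in at_top. dini_le energy t (- dissipation t + K * t powr (-\<sigma>))"
    using eventually_coefficients eventually_gt_at_top[of t0] eventually_ge_at_top[of 1]
  proof eventually_elim
    case (elim t)
    define s where "s = t powr (-q)"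
    define l where "l = 2 * n * p / t"
    define b' where "b' = - (\<beta> * q * t powr (-q-1))"
    have t: "t > 0" "t \<ge> 1" "t > t0" using elim by auto
    have s: "s > 0" using t by (simp add: s_def)
    have e: "eps t > 0" using eps_pos t by simp
    have rw: "w t = (y t - X t) - b t *\<^sub>R v t" by (simp add: w_def y_eq)
    have "inner (N t) ((1 + b') *\<^sub>R v t + b t *\<^sub>R (- damp t *\<^sub>R v t - N t)) + inner (v t) (- damp t *\<^sub>R v t - N t)
      + (- (q * c * t powr (-q-1))) * inner (v t) (w t)
      + c * s * (inner (v t) (v t) + inner (- damp t *\<^sub>R v t - N t) (w t)) + 2 * c\<^sup>2 * s\<^sup>2 * inner (v t) (w t)
      + l * (c * s * norm (v t) + 2 * c\<^sup>2 * s\<^sup>2 * norm (w t))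
      \<le> - b t / 2 * (norm (N t))\<^sup>2 - c * s * gap t - 3 / 8 * c * s * (norm (v t))\<^sup>2 - c / 8 * s * eps t * (norm (w t))\<^sup>2
      + (2 * l\<^sup>2 * c * s + 16 * l\<^sup>2 * c ^ 3 * s ^ 3 / eps t)" (is "?L \<le> ?R")
      unfolding rw
      by (rule dissipation_estimate) (use elim s e c_pos gap_le_inner[OF t(1)] in \<open>auto simp: s_def b'_def\<close>)
    also have "\<dots> = - dissipation t + (2 * l\<^sup>2 * c * s + 16 * l\<^sup>2 * c ^ 3 * s ^ 3 / eps t)"
      by (simp add: dissipation_def s_def)
    finally have 1: "?L \<le> - dissipation t + (2 * l\<^sup>2 * c * s + 16 * l\<^sup>2 * c ^ 3 * s ^ 3 / eps t)" .
    have D: "dini_le energy t (?L + p * eps t / t * (n\<^sup>2 / 2))"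
      using energy_dini[OF t(3) z] unfolding s_def b'_def l_def n_def .
    have tk: "t powr k / t = t powr (k - 1)" for k using t by (simp add: powr_diff)
    have l2: "l\<^sup>2 = 4 * n\<^sup>2 * p\<^sup>2 * t powr (-2)"
      using t by (simp add: l_def power_divide power_mult_distrib powr_minus powr_numeral divide_inverse power_inverse)
    have "2 * l\<^sup>2 * c * s = 8 * n\<^sup>2 * p\<^sup>2 * c * t powr (-2-q)"
      by (simp add: l2 s_def powr_diff powr_minus divide_inverse)
    also have "\<dots> \<le> 8 * n\<^sup>2 * p\<^sup>2 * c * t powr (-\<sigma>)"
      using t c_pos p by (intro mult_left_mono powr_mono) (auto simp: \<sigma>_def)
    finally have e1: "2 * l\<^sup>2 * c * s \<le> 8 * n\<^sup>2 * p\<^sup>2 * c * t powr (-\<sigma>)" .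
    have "s ^ 3 = t powr (-3 * q)" using t by (simp add: s_def powr_power mult.commute)
    then have "16 * l\<^sup>2 * c ^ 3 * s ^ 3 / eps t = 64 * n\<^sup>2 * p\<^sup>2 * c ^ 3 / a * (t powr (-2) * t powr (-3 * q) / t powr (-p))"
      by (simp add: l2 eps_eq)
    also have "t powr (-2) * t powr (-3 * q) / t powr (-p) = t powr (-2 + (-3 * q) - (-p))"
      by (simp only: powr_add powr_diff)
    also have "-2 + (-3 * q) - (-p) = p - 3 * q - 2" by simp
    also have "64 * n\<^sup>2 * p\<^sup>2 * c ^ 3 / a * t powr (p - 3 * q - 2) \<le> 64 * n\<^sup>2 * p\<^sup>2 * c ^ 3 / a * t powr (-\<sigma>)"
      using t c_pos a by (intro mult_left_mono powr_mono) (auto simp: \<sigma>_def)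
    finally have e2: "16 * l\<^sup>2 * c ^ 3 * s ^ 3 / eps t \<le> 64 * n\<^sup>2 * p\<^sup>2 * c ^ 3 / a * t powr (-\<sigma>)" .
    have "p * eps t / t * (n\<^sup>2 / 2) = p * a * n\<^sup>2 / 2 * t powr (-p-1)"
      by (simp add: eps_eq tk[symmetric] mult_ac)
    also have "\<dots> \<le> p * a * n\<^sup>2 / 2 * t powr (-\<sigma>)"
      using t a p_bounds by (intro mult_left_mono powr_mono) (auto simp: \<sigma>_def)
    finally have e3: "p * eps t / t * (n\<^sup>2 / 2) \<le> p * a * n\<^sup>2 / 2 * t powr (-\<sigma>)" .
    have "?L + p * eps t / t * (n\<^sup>2 / 2) \<le> - dissipation t + K * t powr (-\<sigma>)"
      using 1 e1 e2 e3 unfolding K_def distrib_right by linarith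
    with D show ?case by (rule dini_le_mono)
  qed
  moreover have "K \<ge> 0" using c_pos a p_bounds by (simp add: K_def)
  ultimately show ?thesis by blast
qed

lemma energy_decay: "\<exists>M\<ge>0. \<forall>\<^sub>F t in at_top. energy t \<le> M * t powr (\<rho> - \<sigma>)"
proof -
  obtain K where K: "K \<ge> 0" "\<forall>\<^sub>F t in at_top. dini_le energy t (- dissipation t + K * t powr (-\<sigma>))"
    using energy_dissipation by blast
  \<comment> \<open>The bound 3/8 c serves the gap and velocity terms; a / (16 c) makes 2 c^2 k at
    most c a / 8, the coefficient available for norm w ^ 2.\<close>
  define k where "k = min (3/8 * c) (a / (16 * c))"
  have k: "k > 0" "k \<le> 3/8 * c" "k * (16 * c) \<le> a" using a c_pos by (auto simp: k_def field_simps min_def)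
  have r: "\<rho> < 1" "q \<le> \<rho>" "p - q \<le> \<rho>" using p q by (auto simp: \<rho>_def)
  have "\<forall>\<^sub>F t in at_top. \<bar>\<sigma> - \<rho>\<bar> * t powr (-1) \<le> k / 2 * t powr (-\<rho>)"
    using k r by (intro powr_mult_le_eventually) auto
  then have "\<forall>\<^sub>F t in at_top. t \<ge> 1 \<and> t > t0 \<and> b t > 0 \<and> \<bar>\<sigma> - \<rho>\<bar> * t powr (-1) \<le> k / 2 * t powr (-\<rho>)
      \<and> dini_le energy t (- dissipation t + K * t powr (-\<sigma>))"
    using K(2) eventually_coefficients eventually_ge_at_top[of 1] eventually_gt_at_top[of t0]
    by eventually_elim blast
  then obtain T where T: "\<And>t. t \<ge> T \<Longrightarrow> t \<ge> 1 \<and> t > t0 \<and> b t > 0 \<and> \<bar>\<sigma> - \<rho>\<bar> * t powr (-1) \<le> k / 2 * t powr (-\<rho>)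
      \<and> dini_le energy t (- dissipation t + K * t powr (-\<sigma>))"
    by (auto simp: eventually_at_top_linorder)
  \<comment> \<open>The energy is scaled by its expected rate. The derivative of the weight has
    relative size 1 / t, and \<rho> < 1 lets half of the damping absorb it.\<close>
  define Z where "Z = (\<lambda>t. t powr (\<sigma> - \<rho>) * energy t)"
  have "Z t \<le> max (Z T) (K / (k / 2))" if "t \<ge> T" for t
  proof (rule dini_le_decay[OF _ _ _ r(1) _ that])
    show "continuous_on {T..} Z" unfolding Z_def
      using T[of T] by (intro continuous_intros continuous_on_subset[OF continuous_energy] continuous_on_subset[OF continuous_powr]) auto
    show "T > 0" using T[of T] by auto
    show "k / 2 > 0" using k by simp
    fix t assume tT: "t \<ge> T"
    have t: "t > 0" "t \<ge> 1" "t > t0" and b0: "b t > 0" and D: "dini_le energy t (- dissipation t + K * t powr (-\<sigma>))"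
      and small: "\<bar>\<sigma> - \<rho>\<bar> * t powr (-1) \<le> k / 2 * t powr (-\<rho>)" using T[OF tT] by auto
    have E0: "energy t \<ge> 0"
    proof -
      have "0 \<le> gap t + 1/6 * (norm (v t))\<^sup>2 + c\<^sup>2 / 6 * (t powr (-q))\<^sup>2 * (norm (w t))\<^sup>2"
        using gap_nonneg[OF t(1)] by simp
      then show ?thesis using energy_ge(1)[OF t(1)] by linarith
    qed
    have diss: "k * t powr (-\<rho>) * energy t \<le> dissipation t"
    proof -
      have rq: "t powr (-\<rho>) \<le> t powr (-q)" using t r by (intro powr_mono) auto
      have "k * t powr (-\<rho>) * energy t
          \<le> k * t powr (-\<rho>) * (gap t + (norm (v t))\<^sup>2 + 2 * c\<^sup>2 * (t powr (-q))\<^sup>2 * (norm (w t))\<^sup>2)"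
        using k energy_ge(2)[OF t(1)] by (intro mult_left_mono) auto
      also have "\<dots> = k * t powr (-\<rho>) * gap t + k * t powr (-\<rho>) * (norm (v t))\<^sup>2
          + 2 * c\<^sup>2 * k * (t powr (-\<rho>) * (t powr (-q))\<^sup>2) * (norm (w t))\<^sup>2" by (simp add: algebra_simps)
      also have "\<dots> \<le> c * t powr (-q) * gap t + 3/8 * c * t powr (-q) * (norm (v t))\<^sup>2
          + c / 8 * t powr (-q) * eps t * (norm (w t))\<^sup>2"
      proof (intro add_mono mult_right_mono)
        have "k * t powr (-\<rho>) \<le> k * t powr (-q)" using k rq by (intro mult_left_mono) auto
        moreover have "k * t powr (-q) \<le> 3/8 * c * t powr (-q)" using k by (intro mult_right_mono) auto
        moreover have "3/8 * c * t powr (-q) \<le> c * t powr (-q)" using c_pos by (intro mult_right_mono) auto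
        ultimately show "k * t powr (-\<rho>) \<le> c * t powr (-q)" "k * t powr (-\<rho>) \<le> 3/8 * c * t powr (-q)"
          by linarith+
        have "t powr (-\<rho>) * (t powr (-q))\<^sup>2 = t powr (-\<rho> - 2 * q)"
          by (simp add: power2_eq_square powr_add[symmetric])
        also have "\<dots> \<le> t powr (-q - p)" using t r by (intro powr_mono) auto
        also have "\<dots> = t powr (-q) * t powr (-p)" using powr_add[of t "-q" "-p"] by simp
        finally have "2 * c\<^sup>2 * k * (t powr (-\<rho>) * (t powr (-q))\<^sup>2) \<le> 2 * c\<^sup>2 * k * (t powr (-q) * t powr (-p))"
          using k by (intro mult_left_mono) auto
        also have "\<dots> = c / 8 * (k * (16 * c)) * (t powr (-q) * t powr (-p))" by (simp add: power2_eq_square)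
        also have "\<dots> \<le> c / 8 * a * (t powr (-q) * t powr (-p))"
          using k c_pos by (intro mult_left_mono mult_right_mono) auto
        finally show "2 * c\<^sup>2 * k * (t powr (-\<rho>) * (t powr (-q))\<^sup>2) \<le> c / 8 * t powr (-q) * eps t"
          by (simp add: eps_eq mult_ac)
      qed (use gap_nonneg[OF t(1)] in auto)
      also have "\<dots> \<le> dissipation t" using b0 by (simp add: dissipation_def)
      finally show ?thesis .
    qed
    have "((\<lambda>t. t powr (\<sigma> - \<rho>)) has_real_derivative (\<sigma> - \<rho>) * t powr (\<sigma> - \<rho> - 1)) (at t)"
      using t by (intro has_real_derivative_powr) auto
    then have "dini_le Z t (t powr (\<sigma> - \<rho>) * (- dissipation t + K * t powr (-\<sigma>))
        + (\<sigma> - \<rho>) * t powr (\<sigma> - \<rho> - 1) * energy t)"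
      unfolding Z_def using t D by (intro dini_le_mult) auto
    moreover have "t powr (\<sigma> - \<rho>) * (- dissipation t + K * t powr (-\<sigma>)) + (\<sigma> - \<rho>) * t powr (\<sigma> - \<rho> - 1) * energy t
        \<le> - (k / 2) * t powr (-\<rho>) * Z t + K * t powr (-\<rho>)"
    proof -
      have "(\<sigma> - \<rho>) * t powr (\<sigma> - \<rho> - 1) * energy t = (\<sigma> - \<rho>) * t powr (-1) * Z t"
        using t by (simp add: Z_def powr_diff powr_minus divide_inverse)
      also have "\<dots> \<le> k / 2 * t powr (-\<rho>) * Z t"
      proof (rule mult_right_mono)
        have "(\<sigma> - \<rho>) * t powr (-1) \<le> \<bar>\<sigma> - \<rho>\<bar> * t powr (-1)" by (intro mult_right_mono) auto
        then show "(\<sigma> - \<rho>) * t powr (-1) \<le> k / 2 * t powr (-\<rho>)" using small by linarith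
      qed (use E0 in \<open>simp add: Z_def\<close>)
      finally have 1: "(\<sigma> - \<rho>) * t powr (\<sigma> - \<rho> - 1) * energy t \<le> k / 2 * t powr (-\<rho>) * Z t" .
      have "t powr (\<sigma> - \<rho>) * (- dissipation t + K * t powr (-\<sigma>))
          \<le> t powr (\<sigma> - \<rho>) * (- (k * t powr (-\<rho>) * energy t) + K * t powr (-\<sigma>))"
        using diss by (intro mult_left_mono) auto
      also have "\<dots> = - (k * t powr (-\<rho>) * Z t) + K * (t powr (\<sigma> - \<rho>) * t powr (-\<sigma>))"
        by (simp add: Z_def algebra_simps)
      also have "t powr (\<sigma> - \<rho>) * t powr (-\<sigma>) = t powr (-\<rho>)" by (simp add: powr_add[symmetric])
      finally show ?thesis using 1 by (simp add: algebra_simps)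
    qed
    ultimately show "dini_le Z t (- (k / 2) * t powr (-\<rho>) * Z t + K * t powr (-\<rho>))" by (rule dini_le_mono)
  qed
  then have "energy t \<le> max (Z T) (K / (k / 2)) * t powr (\<rho> - \<sigma>)" if "t \<ge> T" for t
  proof -
    have "t > 0" using T[OF that] by auto
    have "energy t = Z t * t powr (\<rho> - \<sigma>)"
      using \<open>t > 0\<close> by (simp add: Z_def powr_diff)
    also have "\<dots> \<le> max (Z T) (K / (k / 2)) * t powr (\<rho> - \<sigma>)"
      using \<open>t \<ge> T \<Longrightarrow> Z t \<le> max (Z T) (K / (k / 2))\<close> that by (intro mult_right_mono) auto
    finally show ?thesis .
  qed
  moreover have "max (Z T) (K / (k / 2)) \<ge> 0" using K k by (simp add: le_max_iff_disj)
  ultimately show ?thesis by (auto simp: eventually_at_top_linorder)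
qed

end

section \<open>Rates and integral estimates\<close>

lemma set_integrable_eventually_bound:
  fixes f h :: "real \<Rightarrow> real"
  assumes cont: "continuous_on {T0..} f" and h: "set_integrable lborel {T1..} h"
    and bound: "\<forall>\<^sub>F t in at_top. \<bar>f t\<bar> \<le> h t"
  shows "set_integrable lborel {T0..} f"
proof -
  obtain T2 where T2: "\<And>t. t \<ge> T2 \<Longrightarrow> \<bar>f t\<bar> \<le> h t"
    using bound by (auto simp: eventually_at_top_linorder)
  define T where "T = max T0 (max T1 T2)"
  have "set_integrable lborel {T..} h"
    by (rule set_integrable_subset[OF h]) (auto simp: T_def)
  then show ?thesis
    by (intro set_integrable_tail_bound[OF cont, of T]) (auto simp: T_def T2)
qed

lemma norm_le_powr_half:
  assumes "(norm u)\<^sup>2 \<le> M * t powr k" "M \<ge> 0"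
  shows "norm u \<le> sqrt M * t powr (k / 2)"
proof (rule power2_le_imp_le)
  have "(sqrt M * t powr (k / 2))\<^sup>2 = M * (t powr (k / 2) * t powr (k / 2))"
    using assms(2) by (simp add: power_mult_distrib power2_eq_square[of "t powr _"])
  then show "(norm u)\<^sup>2 \<le> (sqrt M * t powr (k / 2))\<^sup>2"
    using assms(1) by (simp add: powr_add[symmetric])
qed (use assms(2) in simp)

lemma tendsto_zero_of_powr_bound:
  assumes "\<forall>\<^sub>F t in at_top. (norm (f t))\<^sup>2 \<le> M * t powr k" "M \<ge> 0" "k < 0"
  shows "(f \<longlongrightarrow> 0) at_top"
proof (rule Lim_null_comparison)
  show "\<forall>\<^sub>F t in at_top. norm (f t) \<le> sqrt M * t powr (k / 2)"
    using assms(1) by eventually_elim (rule norm_le_powr_half[OF _ assms(2)])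
  have "((\<lambda>t. sqrt M * t powr (k / 2)) \<longlongrightarrow> sqrt M * 0) at_top"
    using assms(3) by (intro tendsto_intros tendsto_neg_powr filterlim_ident) auto
  then show "((\<lambda>t. sqrt M * t powr (k / 2)) \<longlongrightarrow> 0) at_top" by simp
qed

context tikhonov_flow begin

text \<open>What is left of t^(2 q) times \<open>dissipation\<close> after paying for the derivative
  of the weight: the norm w ^ 2 term is used up and the other constants are lowered.\<close>

definition weighted_dissipation :: "real \<Rightarrow> real" where
  "weighted_dissipation t = t powr (2 * q) *
    (b t / 2 * (norm (N t))\<^sup>2 + c / 8 * t powr (-q) * (gap t + (norm (v t))\<^sup>2))"

lemma integrable_weighted_dissipation:
  assumes pq: "p > 2 * q"
  shows "\<exists>T. set_integrable lborel {T..} weighted_dissipation"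
proof -
  obtain K where K: "K \<ge> 0" "\<forall>\<^sub>F t in at_top. dini_le energy t (- dissipation t + K * t powr (-\<sigma>))"
    using energy_dissipation by blast
  have "\<forall>\<^sub>F t in at_top. 2 * q * t powr (-1) \<le> c / 4 * t powr (-q)"
    "\<forall>\<^sub>F t in at_top. 4 * q * c\<^sup>2 * t powr (-1-2*q) \<le> c / 8 * a * t powr (-q-p)"
    using c_pos a p q by (intro powr_mult_le_eventually; simp)+
  then have "\<forall>\<^sub>F t in at_top. t \<ge> 1 \<and> t > t0 \<and> b t > 0
      \<and> 2 * q * t powr (-1) \<le> c / 4 * t powr (-q)
      \<and> 4 * q * c\<^sup>2 * t powr (-1-2*q) \<le> c / 8 * a * t powr (-q-p)
      \<and> dini_le energy t (- dissipation t + K * t powr (-\<sigma>))"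
    using K(2) eventually_coefficients eventually_ge_at_top[of 1] eventually_gt_at_top[of t0]
    by eventually_elim blast
  then obtain T where T: "\<And>t. t \<ge> T \<Longrightarrow> t \<ge> 1 \<and> t > t0 \<and> b t > 0
      \<and> 2 * q * t powr (-1) \<le> c / 4 * t powr (-q)
      \<and> 4 * q * c\<^sup>2 * t powr (-1-2*q) \<le> c / 8 * a * t powr (-q-p)
      \<and> dini_le energy t (- dissipation t + K * t powr (-\<sigma>))"
    by (auto simp: eventually_at_top_linorder)
  define Z where "Z = (\<lambda>t. t powr (2 * q) * energy t)"
  have sub: "{T..} \<subseteq> {t0..}" using T[of T] by auto
  have "set_integrable lborel {T+1..} weighted_dissipation"
  proof (rule dini_le_integrable[where Z = Z and k = "2 * q - \<sigma>" and M = K])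
    show "continuous_on {T..} Z" unfolding Z_def
      by (rule continuous_on_subset[OF _ sub]) (intro continuous_intros continuous_powr continuous_energy)
    show "continuous_on {T..} weighted_dissipation" unfolding weighted_dissipation_def[abs_def]
      by (rule continuous_on_subset[OF _ sub])
        (intro continuous_intros continuous_powr continuous_b continuous_N continuous_gap continuous_v, auto)
    show "T > 0" using T[of T] by auto
    \<comment> \<open>Integrability of the error: the branch p + 1 of \<open>\<sigma>\<close>
      requires p > 2 q, the other branch p < q + 1.\<close>
    show "2 * q - \<sigma> < - 1" using pq p by (auto simp: \<sigma>_def)
    show "K \<ge> 0" by fact
    fix t assume tT: "t \<ge> T"
    have t: "t > 0" "t \<ge> 1" "t > t0" and b0: "b t > 0" and D: "dini_le energy t (- dissipation t + K * t powr (-\<sigma>))"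
      and s1: "2 * q * t powr (-1) \<le> c / 4 * t powr (-q)"
      and s2: "4 * q * c\<^sup>2 * t powr (-1-2*q) \<le> c / 8 * a * t powr (-q-p)" using T[OF tT] by auto
    have g0: "gap t \<ge> 0" by (rule gap_nonneg[OF t(1)])
    have "0 \<le> gap t + 1/6 * (norm (v t))\<^sup>2 + c\<^sup>2 / 6 * (t powr (-q))\<^sup>2 * (norm (w t))\<^sup>2"
      using g0 by simp
    then have "energy t \<ge> 0" using energy_ge(1)[OF t(1)] by linarith
    then show "Z t \<ge> 0" by (simp add: Z_def)
    show "weighted_dissipation t \<ge> 0" using b0 g0 c_pos by (simp add: weighted_dissipation_def)
    \<comment> \<open>The derivative of the weight is paid by the dissipation: q < 1 handles the gap
      and the velocity, and p < q + 1 handles norm w ^ 2.\<close>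
    have "2 * q * t powr (-1) * energy t
        \<le> 2 * q * t powr (-1) * (gap t + (norm (v t))\<^sup>2 + 2 * c\<^sup>2 * (t powr (-q))\<^sup>2 * (norm (w t))\<^sup>2)"
      using q energy_ge(2)[OF t(1)] by (intro mult_left_mono) auto
    also have "\<dots> = 2 * q * t powr (-1) * gap t + 2 * q * t powr (-1) * (norm (v t))\<^sup>2
        + 4 * q * c\<^sup>2 * (t powr (-1) * (t powr (-q) * t powr (-q))) * (norm (w t))\<^sup>2"
      by (simp add: power2_eq_square[of "t powr _"] algebra_simps)
    also have "t powr (-1) * (t powr (-q) * t powr (-q)) = t powr (-1-2*q)"
      by (simp only: powr_add[symmetric]) simp
    also have "2 * q * t powr (-1) * gap t + 2 * q * t powr (-1) * (norm (v t))\<^sup>2 + 4 * q * c\<^sup>2 * t powr (-1-2*q) * (norm (w t))\<^sup>2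
        \<le> c / 4 * t powr (-q) * gap t + c / 4 * t powr (-q) * (norm (v t))\<^sup>2 + c / 8 * a * t powr (-q-p) * (norm (w t))\<^sup>2"
      using s1 s2 g0 by (intro add_mono mult_right_mono) auto
    also have "c / 8 * a * t powr (-q-p) = c / 8 * t powr (-q) * eps t"
      using powr_add[of t "-q" "-p"] by (simp add: eps_eq)
    finally have small: "2 * q * t powr (-1) * energy t \<le> c / 4 * t powr (-q) * gap t
        + c / 4 * t powr (-q) * (norm (v t))\<^sup>2 + c / 8 * t powr (-q) * eps t * (norm (w t))\<^sup>2" .
    define P1 P2 where "P1 = c * t powr (-q) * gap t" and "P2 = c * t powr (-q) * (norm (v t))\<^sup>2"
    have P: "P1 \<ge> 0" "P2 \<ge> 0" using c_pos g0 by (auto simp: P1_def P2_def)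
    have "dissipation t = b t / 2 * (norm (N t))\<^sup>2 + P1 + 3/8 * P2 + c / 8 * t powr (-q) * eps t * (norm (w t))\<^sup>2"
      by (simp add: dissipation_def P1_def P2_def)
    moreover have "2 * q * t powr (-1) * energy t \<le> P1 / 4 + P2 / 4 + c / 8 * t powr (-q) * eps t * (norm (w t))\<^sup>2"
      using small by (simp add: P1_def P2_def)
    moreover have "c / 8 * t powr (-q) * (gap t + (norm (v t))\<^sup>2) = P1 / 8 + P2 / 8"
      by (simp add: P1_def P2_def algebra_simps)
    ultimately have le: "- dissipation t + 2 * q * t powr (-1) * energy t
        \<le> - (b t / 2 * (norm (N t))\<^sup>2 + c / 8 * t powr (-q) * (gap t + (norm (v t))\<^sup>2))"
      using P by linarith
    have "((\<lambda>t. t powr (2 * q)) has_real_derivative 2 * q * t powr (2 * q - 1)) (at t)"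
      using t by (intro has_real_derivative_powr) auto
    then have "dini_le Z t (t powr (2 * q) * (- dissipation t + K * t powr (-\<sigma>)) + 2 * q * t powr (2 * q - 1) * energy t)"
      unfolding Z_def using t D by (intro dini_le_mult) auto
    moreover have "t powr (2 * q) * (- dissipation t + K * t powr (-\<sigma>)) + 2 * q * t powr (2 * q - 1) * energy t
        \<le> - weighted_dissipation t + K * t powr (2 * q - \<sigma>)"
    proof -
      have e1: "t powr (2 * q - 1) = t powr (2 * q) * t powr (-1)" "t powr (2 * q - \<sigma>) = t powr (2 * q) * t powr (-\<sigma>)"
        using powr_add[of t "2 * q" "-1"] powr_add[of t "2 * q" "-\<sigma>"] by simp_all
      have "t powr (2 * q) * (- dissipation t + 2 * q * t powr (-1) * energy t) \<le> - weighted_dissipation t"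
        using mult_left_mono[OF le powr_ge_zero[of t "2 * q"]]
        by (simp only: weighted_dissipation_def mult_minus_right)
      then show ?thesis unfolding e1 by (simp add: algebra_simps)
    qed
    ultimately show "dini_le Z t (- weighted_dissipation t + K * t powr (2 * q - \<sigma>))" by (rule dini_le_mono)
  qed
  then show ?thesis by blast
qed

lemma eventually_bounds:
  "\<exists>M\<ge>0. \<forall>\<^sub>F t in at_top. gap t \<le> M * t powr (\<rho> - \<sigma>) \<and> (norm (v t))\<^sup>2 \<le> M * t powr (\<rho> - \<sigma>)
    \<and> (norm (w t))\<^sup>2 \<le> M * t powr (2 * q + \<rho> - \<sigma>)"
proof -
  obtain M where M: "M \<ge> 0" "\<forall>\<^sub>F t in at_top. energy t \<le> M * t powr (\<rho> - \<sigma>)"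
    using energy_decay by blast
  define M' where "M' = 6 * M + 6 / c\<^sup>2 * M"
  have M': "M \<le> M'" "6 * M \<le> M'" "6 / c\<^sup>2 * M \<le> M'" "M' \<ge> 0" using M by (auto simp: M'_def)
  have "\<forall>\<^sub>F t in at_top. gap t \<le> M' * t powr (\<rho> - \<sigma>) \<and> (norm (v t))\<^sup>2 \<le> M' * t powr (\<rho> - \<sigma>)
    \<and> (norm (w t))\<^sup>2 \<le> M' * t powr (2 * q + \<rho> - \<sigma>)"
    using M(2) eventually_gt_at_top[of 0]
  proof eventually_elim
    case (elim t)
    define P where "P = t powr (\<rho> - \<sigma>)"
    have P: "P \<ge> 0" by (simp add: P_def)
    define W where "W = c\<^sup>2 * (t powr (-q))\<^sup>2 * (norm (w t))\<^sup>2"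
    have W: "W \<ge> 0" by (simp add: W_def)
    have "gap t + 1/6 * (norm (v t))\<^sup>2 + W / 6 \<le> M * P"
      using energy_ge(1)[OF elim(2)] elim(1) by (simp add: P_def W_def)
    then have 1: "gap t \<le> M * P" "(norm (v t))\<^sup>2 \<le> (6 * M) * P" "W \<le> 6 * (M * P)"
      using W gap_nonneg[OF elim(2)] zero_le_power2[of "norm (v t)"] by linarith+
    have "(norm (w t))\<^sup>2 = 1 / c\<^sup>2 * t powr (2 * q) * W"
    proof -
      have "(t powr (-q))\<^sup>2 * t powr (2 * q) = 1"
        using elim(2) by (simp add: power2_eq_square powr_add[symmetric])
      then show ?thesis using c_pos by (simp add: W_def mult_ac)
    qed
    also have "\<dots> \<le> 1 / c\<^sup>2 * t powr (2 * q) * (6 * (M * P))" using 1 by (intro mult_left_mono) auto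
    also have "\<dots> = 6 / c\<^sup>2 * M * (t powr (2 * q) * P)" by simp
    also have "t powr (2 * q) * P = t powr (2 * q + \<rho> - \<sigma>)"
      using powr_add[of t "2 * q" "\<rho> - \<sigma>"] by (simp add: P_def add_diff_eq)
    finally have 2: "(norm (w t))\<^sup>2 \<le> 6 / c\<^sup>2 * M * t powr (2 * q + \<rho> - \<sigma>)" .
    show ?case
    proof (intro conjI)
      show "gap t \<le> M' * t powr (\<rho> - \<sigma>)" "(norm (v t))\<^sup>2 \<le> M' * t powr (\<rho> - \<sigma>)"
        using 1 mult_right_mono[OF M'(1) P] mult_right_mono[OF M'(2) P] unfolding P_def[symmetric] by linarith+
      show "(norm (w t))\<^sup>2 \<le> M' * t powr (2 * q + \<rho> - \<sigma>)"
        using 2 mult_right_mono[OF M'(3), of "t powr (2 * q + \<rho> - \<sigma>)"] by simp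
    qed
  qed
  with M'(4) show ?thesis by blast
qed

text \<open>For p \<le> 2 q the rate \<open>\<rho>\<close> is q, otherwise it is p - q. For either
  branch of \<open>\<sigma>\<close> the comparison reduces to q < 1 or p < q + 1.\<close>

lemma rate_exponent: "\<rho> - \<sigma> \<le> - min (2 * q) p"
  using p q by (auto simp: \<rho>_def \<sigma>_def min_def max_def)

section \<open>Strong convergence of the trajectory\<close>

lemma v_tendsto: "(v \<longlongrightarrow> 0) at_top"
proof -
  obtain M where M: "M \<ge> 0" "\<forall>\<^sub>F t in at_top. gap t \<le> M * t powr (\<rho> - \<sigma>) \<and> (norm (v t))\<^sup>2 \<le> M * t powr (\<rho> - \<sigma>)
    \<and> (norm (w t))\<^sup>2 \<le> M * t powr (2 * q + \<rho> - \<sigma>)" using eventually_bounds by blast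
  have "\<forall>\<^sub>F t in at_top. (norm (v t))\<^sup>2 \<le> M * t powr (\<rho> - \<sigma>)" using M(2) by eventually_elim blast
  moreover have "\<rho> - \<sigma> < 0" using rate_exponent p_bounds q by (auto simp: min_def split: if_splits)
  ultimately show ?thesis using M(1) by (intro tendsto_zero_of_powr_bound)
qed

lemma bv_tendsto: "((\<lambda>t. b t *\<^sub>R v t) \<longlongrightarrow> 0) at_top"
proof (rule Lim_null_comparison)
  show "\<forall>\<^sub>F t in at_top. norm (b t *\<^sub>R v t) \<le> (\<gamma> + \<bar>\<beta>\<bar>) * norm (v t)"
    using eventually_ge_at_top[of 1] by eventually_elim (auto intro!: mult_right_mono b_le)
  have "((\<lambda>t. (\<gamma> + \<bar>\<beta>\<bar>) * norm (v t)) \<longlongrightarrow> (\<gamma> + \<bar>\<beta>\<bar>) * norm (0::'a)) at_top"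
    by (intro tendsto_intros v_tendsto)
  then show "((\<lambda>t. (\<gamma> + \<bar>\<beta>\<bar>) * norm (v t)) \<longlongrightarrow> 0) at_top" by simp
qed

text \<open>For \<open>p > 2 * q\<close> the bound on the energy controls the distance to \<open>X\<close> directly; otherwise
  that bound may blow up, and the strong convexity of the regularised function is used instead.\<close>

lemma w_tendsto: "(w \<longlongrightarrow> 0) at_top"
proof -
  obtain M where M: "M \<ge> 0" "\<forall>\<^sub>F t in at_top. gap t \<le> M * t powr (\<rho> - \<sigma>) \<and> (norm (v t))\<^sup>2 \<le> M * t powr (\<rho> - \<sigma>)
    \<and> (norm (w t))\<^sup>2 \<le> M * t powr (2 * q + \<rho> - \<sigma>)" using eventually_bounds by blast
  show ?thesis
  proof (cases "p > 2 * q")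
    case True
    have "\<forall>\<^sub>F t in at_top. (norm (w t))\<^sup>2 \<le> M * t powr (2 * q + \<rho> - \<sigma>)" using M(2) by eventually_elim blast
    moreover have "2 * q + \<rho> - \<sigma> < 0" using True p q by (auto simp: \<rho>_def \<sigma>_def)
    ultimately show ?thesis using M(1) by (intro tendsto_zero_of_powr_bound)
  next
    case False
    have "\<forall>\<^sub>F t in at_top. (norm (y t - X t))\<^sup>2 \<le> 2 / a * M * t powr (p + \<rho> - \<sigma>)"
      using M(2) eventually_gt_at_top[of 0]
    proof eventually_elim
      case (elim t)
      have "a * t powr (-p) / 2 * (norm (y t - X t))\<^sup>2 \<le> M * t powr (\<rho> - \<sigma>)"
        using gap_ge[OF elim(2)] elim(1) by (simp add: eps_eq)
      moreover have "t powr p * t powr (-p) = 1" using elim(2) by (simp add: powr_add[symmetric])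
      then have "(norm (y t - X t))\<^sup>2 = 2 / a * t powr p * (a * t powr (-p) / 2 * (norm (y t - X t))\<^sup>2)"
        using a by (simp add: mult_ac)
      moreover have "0 \<le> 2 / a * t powr p" using a by simp
      ultimately have "(norm (y t - X t))\<^sup>2 \<le> 2 / a * t powr p * (M * t powr (\<rho> - \<sigma>))"
        by (metis mult_left_mono)
      also have "\<dots> = 2 / a * M * (t powr p * t powr (\<rho> - \<sigma>))" by simp
      also have "t powr p * t powr (\<rho> - \<sigma>) = t powr (p + \<rho> - \<sigma>)"
        using powr_add[of t p "\<rho> - \<sigma>"] by (simp add: add_diff_eq)
      finally show ?case .
    qed
    \<comment> \<open>Here \<rho> = q, so the exponent is the larger of q - 1 and 2 (p - q -
      1).\<close>
    moreover have "p + \<rho> - \<sigma> < 0" using False p q by (auto simp: \<rho>_def \<sigma>_def)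
    ultimately have "((\<lambda>t. y t - X t) \<longlongrightarrow> 0) at_top"
      using M(1) a by (intro tendsto_zero_of_powr_bound[where M = "2 / a * M" and k = "p + \<rho> - \<sigma>"]) auto
    then have "((\<lambda>t. (y t - X t) - b t *\<^sub>R v t) \<longlongrightarrow> 0 - 0) at_top"
      by (intro tendsto_diff bv_tendsto)
    then show ?thesis by (simp add: w_def[abs_def] y_eq)
  qed
qed

lemma eps_tendsto: "(eps \<longlongrightarrow> 0) at_top"
proof -
  have "((\<lambda>t. a * t powr (-p)) \<longlongrightarrow> a * 0) at_top"
    using p_bounds by (intro tendsto_intros tendsto_neg_powr filterlim_ident) auto
  then show ?thesis by (simp add: eps_eq[abs_def])
qed

lemma x_tendsto: "(x \<longlongrightarrow> min_norm_minimizer g) at_top"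
proof -
  have "(X \<longlongrightarrow> min_norm_minimizer g) at_top"
    unfolding X_def[abs_def]
    using eventually_mono[OF eventually_gt_at_top[of 0] eps_pos]
    by (intro tikhonov_min_tendsto eps_tendsto)
  then have "((\<lambda>t. X t + w t) \<longlongrightarrow> min_norm_minimizer g + 0) at_top"
    by (intro tendsto_add w_tendsto)
  then show ?thesis by (simp add: w_def)
qed

text \<open>Makes eps y of order t^(-p), which is what separates the gradient of \<open>g\<close>
  from \<open>N\<close>.\<close>

lemma y_bounded: "\<exists>Y\<ge>0. \<forall>\<^sub>F t in at_top. norm (y t) \<le> Y"
proof -
  have "(y \<longlongrightarrow> min_norm_minimizer g + 0) at_top"
    unfolding y_eq[abs_def] by (intro tendsto_add x_tendsto bv_tendsto)
  then have "((\<lambda>t. norm (y t)) \<longlongrightarrow> norm (min_norm_minimizer g + 0)) at_top" by (rule tendsto_norm)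
  then have "\<forall>\<^sub>F t in at_top. norm (y t) < norm (min_norm_minimizer g + 0) + 1"
    by (rule order_tendstoD(2)) simp
  then have "\<forall>\<^sub>F t in at_top. norm (y t) \<le> norm (min_norm_minimizer g + 0) + 1"
    by eventually_elim simp
  then show ?thesis by (intro exI[of _ "norm (min_norm_minimizer g + 0) + 1"]) auto
qed

section \<open>Rates for the values, the velocity and the distance\<close>

lemma value_rate: "(\<lambda>t. g (y t) - (INF z. g z)) \<in> O[at_top](\<lambda>t. t powr (- min (2 * q) p))"
proof -
  obtain M where M: "M \<ge> 0" "\<forall>\<^sub>F t in at_top. gap t \<le> M * t powr (\<rho> - \<sigma>) \<and> (norm (v t))\<^sup>2 \<le> M * t powr (\<rho> - \<sigma>)
    \<and> (norm (w t))\<^sup>2 \<le> M * t powr (2 * q + \<rho> - \<sigma>)" using eventually_bounds by blast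
  obtain z where z: "z \<in> argmin_set g" using g_argmin by auto
  have inf: "(INF z. g z) = g z"
    by (intro antisym cINF_lower cINF_greatest bdd_belowI2[of _ "g z"] argmin_le[OF z]) auto
  have "\<forall>\<^sub>F t in at_top. norm (g (y t) - (INF z. g z)) \<le> (M + a / 2 * (norm z)\<^sup>2) * norm (t powr (- min (2 * q) p))"
    using M(2) eventually_ge_at_top[of 1]
  proof eventually_elim
    case (elim t)
    then have t: "t > 0" by simp
    \<comment> \<open>Testing the minimality of \<open>X\<close> at \<open>z\<close> replaces the
      regularized minimum by the minimum of \<open>g\<close>, at a cost eps / 2 norm z ^ 2 of order
      t^(-p), which the rate allows.\<close>
    have "tikhonov g (eps t) (X t) \<le> tikhonov g (eps t) z"
      unfolding X_def by (rule tikhonov_min_le[OF eps_pos[OF t]])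
    moreover have "0 \<le> eps t / 2 * (norm (y t))\<^sup>2" using eps_pos[OF t] by simp
    ultimately have "g (y t) - g z \<le> gap t + eps t / 2 * (norm z)\<^sup>2"
      unfolding gap_def tikhonov_def[of g "eps t" "y t"] tikhonov_def[of g "eps t" z] by linarith
    also have "\<dots> \<le> M * t powr (- min (2 * q) p) + a / 2 * (norm z)\<^sup>2 * t powr (- min (2 * q) p)"
    proof (rule add_mono)
      have "M * t powr (\<rho> - \<sigma>) \<le> M * t powr (- min (2 * q) p)"
        using M(1) elim rate_exponent by (intro mult_left_mono powr_mono) auto
      then show "gap t \<le> M * t powr (- min (2 * q) p)" using elim by linarith
      have "a / 2 * (norm z)\<^sup>2 * t powr (-p) \<le> a / 2 * (norm z)\<^sup>2 * t powr (- min (2 * q) p)"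
        using a elim by (intro mult_left_mono powr_mono) auto
      then show "eps t / 2 * (norm z)\<^sup>2 \<le> a / 2 * (norm z)\<^sup>2 * t powr (- min (2 * q) p)"
        by (simp add: eps_eq mult_ac)
    qed
    finally show ?case using argmin_le[OF z, of "y t"] by (simp add: inf distrib_right)
  qed
  then show ?thesis by (rule bigoI)
qed

lemma velocity_rate: "(\<lambda>t. norm (v t)) \<in> O[at_top](\<lambda>t. t powr (- (min (2 * q) p / 2)))"
proof -
  obtain M where M: "M \<ge> 0" "\<forall>\<^sub>F t in at_top. gap t \<le> M * t powr (\<rho> - \<sigma>) \<and> (norm (v t))\<^sup>2 \<le> M * t powr (\<rho> - \<sigma>)
    \<and> (norm (w t))\<^sup>2 \<le> M * t powr (2 * q + \<rho> - \<sigma>)" using eventually_bounds by blast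
  have "\<forall>\<^sub>F t in at_top. norm (norm (v t)) \<le> sqrt M * norm (t powr (- (min (2 * q) p / 2)))"
    using M(2) eventually_ge_at_top[of 1]
  proof eventually_elim
    case (elim t)
    have "norm (v t) \<le> sqrt M * t powr ((\<rho> - \<sigma>) / 2)"
      using elim M(1) by (intro norm_le_powr_half) auto
    also have "\<dots> \<le> sqrt M * t powr (- (min (2 * q) p / 2))"
      using elim M(1) rate_exponent by (intro mult_left_mono powr_mono) auto
    finally show ?case by simp
  qed
  then show ?thesis by (rule bigoI)
qed

text \<open>The two powers match the two branches of \<open>\<sigma>\<close>: p + 1 gives the second
  one by \<rho> < r, and 3 q + 2 - p gives t^(r - 1) because both \<rho> and p - q are below
  r.\<close>

lemma distance_rate:
  assumes r: "max q (p - q) < r" "r < 1"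
  shows "(\<lambda>t. norm (w t)) \<in> O[at_top](\<lambda>t. t powr (r - 1) + t powr ((2 * q + r - p - 1) / 2))"
proof -
  obtain M where M: "M \<ge> 0" "\<forall>\<^sub>F t in at_top. gap t \<le> M * t powr (\<rho> - \<sigma>) \<and> (norm (v t))\<^sup>2 \<le> M * t powr (\<rho> - \<sigma>)
    \<and> (norm (w t))\<^sup>2 \<le> M * t powr (2 * q + \<rho> - \<sigma>)" using eventually_bounds by blast
  have "\<forall>\<^sub>F t in at_top. norm (norm (w t)) \<le> sqrt M * norm (t powr (r - 1) + t powr ((2 * q + r - p - 1) / 2))"
    using M(2) eventually_ge_at_top[of 1]
  proof eventually_elim
    case (elim t)
    have "norm (w t) \<le> sqrt M * t powr ((2 * q + \<rho> - \<sigma>) / 2)"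
      using elim M(1) by (intro norm_le_powr_half) auto
    also have "\<dots> \<le> sqrt M * (t powr (r - 1) + t powr ((2 * q + r - p - 1) / 2))"
    proof (rule mult_left_mono)
      have "(2 * q + \<rho> - \<sigma>) / 2 \<le> r - 1 \<or> (2 * q + \<rho> - \<sigma>) / 2 \<le> (2 * q + r - p - 1) / 2"
        using r by (auto simp: \<rho>_def \<sigma>_def min_def)
      then have "t powr ((2 * q + \<rho> - \<sigma>) / 2) \<le> t powr (r - 1) \<or>
          t powr ((2 * q + \<rho> - \<sigma>) / 2) \<le> t powr ((2 * q + r - p - 1) / 2)"
        using elim by (auto intro: powr_mono)
      then show "t powr ((2 * q + \<rho> - \<sigma>) / 2) \<le> t powr (r - 1) + t powr ((2 * q + r - p - 1) / 2)"
        by (auto intro: order_trans add_increasing add_increasing2)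
    qed (use M(1) in simp)
    finally show ?case by simp
  qed
  then show ?thesis by (rule bigoI)
qed

section \<open>Weighted integral estimates\<close>

lemma weighted_dissipation_ge:
  assumes t: "t > 0" and b: "b t > 0"
  shows "c / 8 * (t powr q * gap t) \<le> weighted_dissipation t"
    and "c / 8 * (t powr q * (norm (v t))\<^sup>2) \<le> weighted_dissipation t"
    and "t powr (2 * q) * (b t / 2 * (norm (N t))\<^sup>2) \<le> weighted_dissipation t"
proof -
  have e: "t powr (2 * q) * t powr (-q) = t powr q" using powr_add[of t "2 * q" "-q"] by simp
  have W: "weighted_dissipation t = t powr (2 * q) * (b t / 2 * (norm (N t))\<^sup>2)
      + c / 8 * (t powr q * gap t) + c / 8 * (t powr q * (norm (v t))\<^sup>2)"
    unfolding weighted_dissipation_def e[symmetric] by (simp add: algebra_simps)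
  have "0 \<le> t powr (2 * q) * (b t / 2 * (norm (N t))\<^sup>2)" "0 \<le> c / 8 * (t powr q * gap t)"
    "0 \<le> c / 8 * (t powr q * (norm (v t))\<^sup>2)" using c_pos b gap_nonneg[OF t] by auto
  then show "c / 8 * (t powr q * gap t) \<le> weighted_dissipation t"
    and "c / 8 * (t powr q * (norm (v t))\<^sup>2) \<le> weighted_dissipation t"
    and "t powr (2 * q) * (b t / 2 * (norm (N t))\<^sup>2) \<le> weighted_dissipation t"
    unfolding W by linarith+
qed

lemma integrable_gap:
  assumes "p > 2 * q"
  shows "set_integrable lborel {t0..} (\<lambda>t. t powr q * gap t)"
proof -
  obtain T where T: "set_integrable lborel {T..} weighted_dissipation"
    using integrable_weighted_dissipation[OF assms] by blast
  show ?thesis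
  proof (rule set_integrable_eventually_bound)
    show "continuous_on {t0..} (\<lambda>t. t powr q * gap t)"
      by (intro continuous_intros continuous_powr continuous_gap)
    show "set_integrable lborel {T..} (\<lambda>t. 8 / c * weighted_dissipation t)"
      using T by (intro set_integrable_mult_right) auto
    show "\<forall>\<^sub>F t in at_top. \<bar>t powr q * gap t\<bar> \<le> 8 / c * weighted_dissipation t"
      using eventually_b_pos eventually_gt_at_top[of 0]
    proof eventually_elim
      case (elim t)
      have "8 / c * (c / 8 * (t powr q * gap t)) \<le> 8 / c * weighted_dissipation t"
        using weighted_dissipation_ge(1)[of t] elim c_pos by (intro mult_left_mono) auto
      then show ?case using c_pos gap_nonneg[OF elim(2)] by simp
    qed
  qed
qed

lemma integrable_velocity:
  assumes "p > 2 * q"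
  shows "set_integrable lborel {t0..} (\<lambda>t. t powr q * (norm (v t))\<^sup>2)"
proof -
  obtain T where T: "set_integrable lborel {T..} weighted_dissipation"
    using integrable_weighted_dissipation[OF assms] by blast
  show ?thesis
  proof (rule set_integrable_eventually_bound)
    show "continuous_on {t0..} (\<lambda>t. t powr q * (norm (v t))\<^sup>2)"
      by (intro continuous_intros continuous_powr continuous_v)
    show "set_integrable lborel {T..} (\<lambda>t. 8 / c * weighted_dissipation t)"
      using T by (intro set_integrable_mult_right) auto
    show "\<forall>\<^sub>F t in at_top. \<bar>t powr q * (norm (v t))\<^sup>2\<bar> \<le> 8 / c * weighted_dissipation t"
      using eventually_b_pos eventually_gt_at_top[of 0]
    proof eventually_elim
      case (elim t)
      have "8 / c * (c / 8 * (t powr q * (norm (v t))\<^sup>2)) \<le> 8 / c * weighted_dissipation t"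
        using weighted_dissipation_ge(2)[of t] elim c_pos by (intro mult_left_mono) auto
      then show ?case using c_pos by simp
    qed
  qed
qed

lemma norm_diff_square_le: "(norm (u - u'))\<^sup>2 \<le> 2 * (norm u)\<^sup>2 + 2 * (norm u')\<^sup>2" for u u' :: 'a
proof -
  have "(norm (u - u'))\<^sup>2 + (norm (u + u'))\<^sup>2 = 2 * (norm u)\<^sup>2 + 2 * (norm u')\<^sup>2"
    by (simp add: power2_norm_eq_inner inner_simps)
  then show ?thesis using zero_le_power2[of "norm (u + u')"] by linarith
qed

lemma N_weighted_gamma_pos:
  assumes "\<gamma> > 0"
  shows "\<forall>\<^sub>F t in at_top. t powr (2 * q) * (norm (N t))\<^sup>2 \<le> 4 / \<gamma> * weighted_dissipation t"
proof -
  have "\<forall>\<^sub>F t in at_top. \<bar>\<beta>\<bar> * t powr (-q) \<le> \<gamma> / 2 * t powr 0"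
    using assms q by (intro powr_mult_le_eventually) auto
  then show ?thesis using eventually_gt_at_top[of 0]
  proof eventually_elim
    case (elim t)
    have "\<bar>\<beta> * t powr (-q)\<bar> \<le> \<gamma> / 2" using elim by (simp add: abs_mult)
    then have b: "b t \<ge> \<gamma> / 2" unfolding b_eq by linarith
    have "\<gamma> / 4 * (t powr (2 * q) * (norm (N t))\<^sup>2) \<le> b t / 2 * (t powr (2 * q) * (norm (N t))\<^sup>2)"
      using b by (intro mult_right_mono) auto
    also have "\<dots> = t powr (2 * q) * (b t / 2 * (norm (N t))\<^sup>2)" by simp
    also have "\<dots> \<le> weighted_dissipation t"
      using weighted_dissipation_ge(3)[of t] elim b assms by simp
    finally have "4 / \<gamma> * (\<gamma> / 4 * (t powr (2 * q) * (norm (N t))\<^sup>2)) \<le> 4 / \<gamma> * weighted_dissipation t"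
      using assms by (intro mult_left_mono) auto
    then show ?case using assms by simp
  qed
qed

text \<open>The gradient is N - eps y with y bounded, so besides the dissipation only t^(k - 2 p)
  has to be integrable. The condition reads p > (2 q + 1) / 2 for k = 2 q and p > q for k = 2 q -
  1.\<close>

lemma integrable_grad:
  assumes pq: "p > 2 * q" and k: "k - 2 * p < - 1"
    and bound: "\<forall>\<^sub>F t in at_top. t powr k * (norm (N t))\<^sup>2 \<le> C * weighted_dissipation t"
  shows "set_integrable lborel {t0..} (\<lambda>t. t powr k * (norm (grad g (y t)))\<^sup>2)"
proof -
  obtain T where T: "set_integrable lborel {T..} weighted_dissipation"
    using integrable_weighted_dissipation[OF pq] by blast
  obtain Y where Y: "Y \<ge> 0" "\<forall>\<^sub>F t in at_top. norm (y t) \<le> Y" using y_bounded by blast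
  define T' where "T' = max T 1"
  have T': "set_integrable lborel {T'..} weighted_dissipation"
    by (rule set_integrable_subset[OF T]) (auto simp: T'_def)
  show ?thesis
  proof (rule set_integrable_eventually_bound)
    show "continuous_on {t0..} (\<lambda>t. t powr k * (norm (grad g (y t)))\<^sup>2)"
      by (intro continuous_intros continuous_powr continuous_grad_y)
    show "set_integrable lborel {T'..} (\<lambda>t. 2 * C * weighted_dissipation t + 2 * a\<^sup>2 * Y\<^sup>2 * t powr (k - 2 * p))"
      using T' set_integrable_powr[OF _ k, of T'] by (intro set_integral_add set_integrable_mult_right) (auto simp: T'_def)
    show "\<forall>\<^sub>F t in at_top. \<bar>t powr k * (norm (grad g (y t)))\<^sup>2\<bar>
        \<le> 2 * C * weighted_dissipation t + 2 * a\<^sup>2 * Y\<^sup>2 * t powr (k - 2 * p)"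
      using bound Y(2) eventually_gt_at_top[of 0]
    proof eventually_elim
      case (elim t)
      have "grad g (y t) = N t - eps t *\<^sub>R y t" by (simp add: N_def)
      then have "(norm (grad g (y t)))\<^sup>2 \<le> 2 * (norm (N t))\<^sup>2 + 2 * (norm (eps t *\<^sub>R y t))\<^sup>2"
        by (simp only: norm_diff_square_le)
      also have "(norm (eps t *\<^sub>R y t))\<^sup>2 = (eps t)\<^sup>2 * (norm (y t))\<^sup>2"
        by (simp add: power_mult_distrib)
      also have "\<dots> \<le> (eps t)\<^sup>2 * Y\<^sup>2" using elim by (intro mult_left_mono power_mono) auto
      also have "(eps t)\<^sup>2 = a\<^sup>2 * t powr (- (2 * p))"
        by (simp add: eps_eq power_mult_distrib power2_eq_square[of "t powr _"] powr_add[symmetric])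
      finally have "t powr k * (norm (grad g (y t)))\<^sup>2 \<le> t powr k * (2 * (norm (N t))\<^sup>2 + 2 * (a\<^sup>2 * t powr (- (2 * p)) * Y\<^sup>2))"
        by (intro mult_left_mono) auto
      also have "\<dots> = 2 * (t powr k * (norm (N t))\<^sup>2) + 2 * a\<^sup>2 * Y\<^sup>2 * (t powr k * t powr (- (2 * p)))"
        by (simp add: algebra_simps)
      also have "t powr k * t powr (- (2 * p)) = t powr (k - 2 * p)"
        by (simp add: powr_add[symmetric])
      finally show ?case using elim by simp
    qed
  qed
qed

text \<open>With eps x in place of eps y the vector differs from \<open>N\<close> by eps b v only.
  Its weighted square is covered by the velocity part of the dissipation, since eps b^2 is bounded
  and t^(2 q - p) \<le> t^q for t \<ge> 1.\<close>

lemma integrable_regularized_grad: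
  assumes pq: "p > 2 * q" and g0: "\<gamma> > 0"
  shows "set_integrable lborel {t0..} (\<lambda>t. t powr (2 * q) * (norm (grad g (y t) + (a * t powr (-p)) *\<^sub>R x t))\<^sup>2)"
proof -
  obtain T where T: "set_integrable lborel {T..} weighted_dissipation"
    using integrable_weighted_dissipation[OF pq] by blast
  show ?thesis
  proof (rule set_integrable_eventually_bound)
    show "continuous_on {t0..} (\<lambda>t. t powr (2 * q) * (norm (grad g (y t) + (a * t powr (-p)) *\<^sub>R x t))\<^sup>2)"
      by (intro continuous_intros continuous_powr continuous_grad_y continuous_x)
    show "set_integrable lborel {T..} (\<lambda>t. (8 / \<gamma> + 4 * a / c) * weighted_dissipation t)"
      using T by (intro set_integrable_mult_right) auto
    show "\<forall>\<^sub>F t in at_top. \<bar>t powr (2 * q) * (norm (grad g (y t) + (a * t powr (-p)) *\<^sub>R x t))\<^sup>2\<bar>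
        \<le> (8 / \<gamma> + 4 * a / c) * weighted_dissipation t"
      using N_weighted_gamma_pos[OF g0] eventually_coefficients eventually_ge_at_top[of 1]
    proof eventually_elim
      case (elim t)
      then have t: "t > 0" by simp
      have "grad g (y t) + (a * t powr (-p)) *\<^sub>R x t = N t - (eps t * b t) *\<^sub>R v t"
        by (simp add: N_def y_eq eps_eq scaleR_add_right)
      then have "(norm (grad g (y t) + (a * t powr (-p)) *\<^sub>R x t))\<^sup>2 \<le> 2 * (norm (N t))\<^sup>2 + 2 * (norm ((eps t * b t) *\<^sub>R v t))\<^sup>2"
        by (simp only: norm_diff_square_le)
      also have "2 * (norm ((eps t * b t) *\<^sub>R v t))\<^sup>2 = eps t * (b t)\<^sup>2 * (2 * eps t * (norm (v t))\<^sup>2)"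
        by (simp add: power_mult_distrib power2_eq_square[of "eps t"])
      also have "\<dots> \<le> 1/4 * (2 * eps t * (norm (v t))\<^sup>2)"
        using elim eps_pos[OF t] by (intro mult_right_mono) auto
      finally have "t powr (2 * q) * (norm (grad g (y t) + (a * t powr (-p)) *\<^sub>R x t))\<^sup>2
          \<le> t powr (2 * q) * (2 * (norm (N t))\<^sup>2 + 1/4 * (2 * eps t * (norm (v t))\<^sup>2))"
        by (intro mult_left_mono) auto
      also have "\<dots> = 2 * (t powr (2 * q) * (norm (N t))\<^sup>2) + a / 2 * (t powr (2 * q) * t powr (-p) * (norm (v t))\<^sup>2)"
        by (simp add: eps_eq algebra_simps)
      also have "t powr (2 * q) * t powr (-p) * (norm (v t))\<^sup>2 \<le> t powr q * (norm (v t))\<^sup>2"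
        using elim p by (intro mult_right_mono) (auto simp: powr_add[symmetric] intro!: powr_mono)
      also have "a / 2 * (t powr q * (norm (v t))\<^sup>2) = 4 * a / c * (c / 8 * (t powr q * (norm (v t))\<^sup>2))"
        using c_pos by simp
      also have "\<dots> \<le> 4 * a / c * weighted_dissipation t"
        using weighted_dissipation_ge(2)[OF t] elim a c_pos by (intro mult_left_mono) auto
      finally show ?case using elim a by (simp add: distrib_right)
    qed
  qed
qed

text \<open>Here b = \<beta> t^(-q), so the dissipation controls norm N ^ 2 with weight t^q, which
  dominates t^(2 q - 1) for t \<ge> 1.\<close>

lemma N_weighted_gamma_zero:
  assumes "\<gamma> = 0"
  shows "\<forall>\<^sub>F t in at_top. t powr (2 * q - 1) * (norm (N t))\<^sup>2 \<le> 2 / \<beta> * weighted_dissipation t"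
  using eventually_ge_at_top[of 1]
proof eventually_elim
  case (elim t)
  have be: "\<beta> > 0" using assms gamma_beta by auto
  have b: "b t = \<beta> * t powr (-q)" unfolding b_eq by (simp add: assms)
  have "t powr (2 * q - 1) \<le> t powr q" using elim q by (intro powr_mono) auto
  also have "t powr q = t powr (2 * q) * t powr (-q)" using powr_add[of t "2 * q" "-q"] by simp
  also have "\<dots> = 2 / \<beta> * (t powr (2 * q) * (b t / 2))" using be by (simp add: b)
  finally have "t powr (2 * q - 1) * (norm (N t))\<^sup>2 \<le> 2 / \<beta> * (t powr (2 * q) * (b t / 2)) * (norm (N t))\<^sup>2"
    by (intro mult_right_mono) auto
  also have "\<dots> = 2 / \<beta> * (t powr (2 * q) * (b t / 2 * (norm (N t))\<^sup>2))" by simp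
  also have "\<dots> \<le> 2 / \<beta> * weighted_dissipation t"
    using weighted_dissipation_ge(3)[of t] elim be b by (intro mult_left_mono) auto
  finally show ?case .
qed

end

theorem corollary12:
  fixes g :: "'a::{real_inner, complete_space} \<Rightarrow> real"
    and x :: "real \<Rightarrow> 'a" and u0 v0 :: 'a
    and t0 \<alpha> \<beta> \<gamma> q p a :: real
    and \<epsilon> :: "real \<Rightarrow> real"
  assumes g_convex: "convex_on UNIV g"
    and g_diff: "\<And>y. g differentiable (at y)"
    and g_lip: "\<And>B. bounded B \<Longrightarrow> \<exists>L. L-lipschitz_on B (grad g)"
    and g_argmin: "argmin_set g \<noteq> {}"
    and t0: "t0 > 0" and alpha: "\<alpha> > 0" and q: "0 < q" "q < 1"
    and gamma_beta: "(\<gamma> > 0) \<or> (\<gamma> = 0 \<and> \<beta> > 0)"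
    and t0_beta: "\<beta> < 0 \<Longrightarrow> t0 > \<bar>\<beta> / \<gamma>\<bar> powr (1 / q)"
    and a: "a > 0" and p: "q \<le> p" "p < q + 1"
    and eps: "\<And>t. \<epsilon> t = a / t powr p"
    and p_eq_q: "p = q \<Longrightarrow> \<gamma> > 0 \<Longrightarrow> a \<le> \<alpha> / (2 * \<gamma>)"
    and sol: "DS_solution g t0 \<alpha> q \<gamma> \<beta> \<epsilon> u0 v0 x"
  shows
    "((x \<longlongrightarrow> min_norm_minimizer g) at_top)
   \<and>
     ((\<lambda>t. g (shifted t0 \<gamma> \<beta> q x t) - (INF y. g y)) \<in> O[at_top](\<lambda>t. t powr (- min (2 * q) p))
    \<and> (\<lambda>t. norm (velocity t0 x t)) \<in> O[at_top](\<lambda>t. t powr (- (min (2 * q) p / 2)))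
    \<and> (\<forall>r. max q (p - q) < r \<and> r < 1 \<longrightarrow>
         (\<lambda>t. norm (x t - tikhonov_min g (\<epsilon> t)))
           \<in> O[at_top](\<lambda>t. t powr (r - 1) + t powr ((2 * q + r - p - 1) / 2))))
   \<and>
     (p > 2 * q \<longrightarrow>
        set_integrable lborel {t0..}
          (\<lambda>t. t powr q * (tikhonov g (\<epsilon> t) (shifted t0 \<gamma> \<beta> q x t)
                             - tikhonov g (\<epsilon> t) (tikhonov_min g (\<epsilon> t))))
      \<and> set_integrable lborel {t0..} (\<lambda>t. t powr q * (norm (velocity t0 x t))\<^sup>2)
      \<and> (\<gamma> > 0 \<longrightarrow> set_integrable lborel {t0..}
          (\<lambda>t. t powr (2 * q) *
             (norm (grad g (shifted t0 \<gamma> \<beta> q x t) + (a * t powr (- p)) *\<^sub>R x t))\<^sup>2))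
      \<and> (\<gamma> = 0 \<longrightarrow> set_integrable lborel {t0..}
          (\<lambda>t. t powr (2 * q - 1) * (norm (grad g (shifted t0 \<gamma> \<beta> q x t)))\<^sup>2)))
   \<and>
     (p > max ((2 * q + 1) / 2) (2 * q) \<and> \<gamma> > 0 \<longrightarrow>
        set_integrable lborel {t0..}
          (\<lambda>t. t powr (2 * q) * (norm (grad g (shifted t0 \<gamma> \<beta> q x t)))\<^sup>2))"
proof -
  have e: "\<epsilon> = (\<lambda>t. a / t powr p)" using eps by auto
  interpret F: tikhonov_flow g x u0 v0 t0 \<alpha> \<beta> \<gamma> q p a
    using assms unfolding e by unfold_locales blast+
  have eps_t: "F.eps t = \<epsilon> t" for t by (simp add: F.eps_def eps)
  note defs = F.y_def[symmetric] F.v_def[symmetric]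
  have w: "x t - tikhonov_min g (\<epsilon> t) = F.w t" for t by (simp add: F.w_def F.X_def eps_t)
  have gap: "tikhonov g (\<epsilon> t) (F.y t) - tikhonov g (\<epsilon> t) (tikhonov_min g (\<epsilon> t)) = F.gap t" for t
    by (simp add: F.gap_def F.X_def eps_t)
  show ?thesis
    unfolding defs w gap
  proof (intro conjI impI allI)
    show "set_integrable lborel {t0..} (\<lambda>t. t powr (2 * q) * (norm (grad g (F.y t)))\<^sup>2)"
      if "p > max ((2 * q + 1) / 2) (2 * q) \<and> \<gamma> > 0"
      using that by (intro F.integrable_grad[OF _ _ F.N_weighted_gamma_pos]) auto
    show "set_integrable lborel {t0..} (\<lambda>t. t powr (2 * q - 1) * (norm (grad g (F.y t)))\<^sup>2)"
      if "p > 2 * q" "\<gamma> = 0"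
      using that q by (intro F.integrable_grad[OF _ _ F.N_weighted_gamma_zero]) auto
  qed (auto intro: F.x_tendsto F.value_rate F.velocity_rate F.distance_rate
      F.integrable_gap F.integrable_velocity F.integrable_regularized_grad)
qed

end
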